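(* Let $\Gamma$ be an uncountable set and $1<p<\infty$. There exist two equivalent norms on $\ell_p(\Gamma)$ (that is, two norms each equivalent to the usual norm) whose closed unit balls, each endowed with the weak topology of $\ell_p(\Gamma)$, are not homeomorphic.
   Context: $\ell_p(\Gamma)$ is the real Banach space of functions $x:\Gamma\to\mathbb{R}$ with $\sum_{\gamma\in\Gamma}|x_\gamma|^p<\infty$, with its usual norm; two norms are equivalent if they induce the same topology. *)

theory Defs
  imports "HOL-Analysis.Analysis"
begin

(* A function on Gamma is encoded as a total function vanishing outside Gamma, so that
   the vector space operations are pointwise and equality is equality of functions. *)
definition lp_space :: "real \<Rightarrow> 'a set \<Rightarrow> ('a \<Rightarrow> real) set" where
  "lp_space p \<Gamma> =
     {x. (\<forall>\<gamma>. \<gamma> \<notin> \<Gamma> \<longrightarrow> x \<gamma> = 0) \<and> (\<lambda>\<gamma>. \<bar>x \<gamma>\<bar> powr p) summable_on \<Gamma>}"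

definition lp_norm :: "real \<Rightarrow> 'a set \<Rightarrow> ('a \<Rightarrow> real) \<Rightarrow> real" where
  "lp_norm p \<Gamma> x = (\<Sum>\<^sub>\<infinity>\<gamma>\<in>\<Gamma>. \<bar>x \<gamma>\<bar> powr p) powr (1 / p)"

(* In the following definitions V is meant to be a linear subspace of the space of all
   functions 'a => real; norms and functionals are total functions of which only the
   values on V matter. *)
definition is_norm_on :: "('a \<Rightarrow> real) set \<Rightarrow> (('a \<Rightarrow> real) \<Rightarrow> real) \<Rightarrow> bool" where
  "is_norm_on V N \<longleftrightarrow>
     (\<forall>x\<in>V. 0 \<le> N x) \<and>
     (\<forall>x\<in>V. N x = 0 \<longleftrightarrow> x = (\<lambda>\<gamma>. 0)) \<and>
     (\<forall>x\<in>V. \<forall>c. N (\<lambda>\<gamma>. c * x \<gamma>) = \<bar>c\<bar> * N x) \<and>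
     (\<forall>x\<in>V. \<forall>y\<in>V. N (\<lambda>\<gamma>. x \<gamma> + y \<gamma>) \<le> N x + N y)"

definition norm_topology ::
    "('a \<Rightarrow> real) set \<Rightarrow> (('a \<Rightarrow> real) \<Rightarrow> real) \<Rightarrow> ('a \<Rightarrow> real) topology" where
  "norm_topology V N = Metric_space.mtopology V (\<lambda>x y. N (\<lambda>\<gamma>. x \<gamma> - y \<gamma>))"

definition equivalent_norms_on ::
    "('a \<Rightarrow> real) set \<Rightarrow> (('a \<Rightarrow> real) \<Rightarrow> real) \<Rightarrow> (('a \<Rightarrow> real) \<Rightarrow> real) \<Rightarrow> bool" where
  "equivalent_norms_on V N M \<longleftrightarrow> norm_topology V N = norm_topology V M"

definition continuous_dual ::
    "('a \<Rightarrow> real) set \<Rightarrow> (('a \<Rightarrow> real) \<Rightarrow> real) \<Rightarrow> (('a \<Rightarrow> real) \<Rightarrow> real) set" where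
  "continuous_dual V N =
     {f. (\<forall>x\<in>V. \<forall>y\<in>V. f (\<lambda>\<gamma>. x \<gamma> + y \<gamma>) = f x + f y) \<and>
         (\<forall>x\<in>V. \<forall>c. f (\<lambda>\<gamma>. c * x \<gamma>) = c * f x) \<and>
         continuous_map (norm_topology V N) euclideanreal f}"

definition weak_topology ::
    "('a \<Rightarrow> real) set \<Rightarrow> (('a \<Rightarrow> real) \<Rightarrow> real) \<Rightarrow> ('a \<Rightarrow> real) topology" where
  "weak_topology V N =
     topology_generated_by {{x \<in> V. f x \<in> U} | f U. f \<in> continuous_dual V N \<and> open U}"

definition closed_unit_ball ::
    "('a \<Rightarrow> real) set \<Rightarrow> (('a \<Rightarrow> real) \<Rightarrow> real) \<Rightarrow> ('a \<Rightarrow> real) set" where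
  "closed_unit_ball V N = {x \<in> V. N x \<le> 1}"

end

theory Submission
  imports Defs
begin

text \<open>
  Two balls are told apart by a Ramsey-type property of their open sets. Call a space dichotomous
  if, for every uncountable family of points \<open>x i\<close> with open neighbourhoods \<open>V i\<close>, some uncountable
  subfamily either has all its \<open>V i\<close> meeting pairwise, or admits pairwise disjoint, possibly smaller,
  open neighbourhoods of its \<open>x i\<close>. This is a topological property (\<open>open_dichotomy_homeomorphic\<close>).

  On norm-bounded sets the weak topology is the topology of pointwise convergence
  (\<open>weak_open_contains_coordinate_box\<close>), so every \<open>V i\<close> contains a box given by a finite set \<open>F i\<close>
  of coordinates. The usual ball is dichotomous (\<open>lp_ball_open_dichotomy\<close>) because its norm does not
  see which coordinates are used: passing to a Delta-system with root \<open>R\<close>, to one common box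
  size and to almost equal values on \<open>R\<close>, whether two boxes meet is decided by adding the masses carried
  by \<open>R\<close>, \<open>F i - R\<close> and \<open>F j - R\<close>. Attaching to \<open>i\<close> the number \<open>r i / 2 + s i\<close>, where \<open>r i\<close> and \<open>s i\<close>
  are the masses on \<open>R\<close> and on \<open>F i - R\<close>, two boxes meet if both numbers are at most \<open>1 / 2\<close>, and are
  disjoint after shrinking if both exceed \<open>1 / 2\<close>; one of these cases occurs uncountably often.

  A graph destroys the symmetry. Bounding \<open>\<bar>x a\<bar> + \<bar>x b\<bar>\<close> for all edges gives an equivalent norm
  (\<open>graph_norm\<close>) in whose ball the sum of the unit vectors at \<open>a\<close> and \<open>b\<close> lies exactly when \<open>a b\<close>
  is not an edge. Near the unit vectors, uncountable families of pairwise meeting neighbourhoods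
  would be uncountable independent sets, and pairwise disjoint ones would yield uncountable cliques
  (\<open>graph_ball_not_open_dichotomy\<close>). The Sierpinski graph, comparing a well-order with the order of
  the reals, has neither (\<open>sierpinski_graph\<close>).
\<close>

section \<open>Uncountable combinatorics\<close>

lemma uncountable_fibre:
  assumes "uncountable A" "countable (f ` A)"
  obtains y where "uncountable {x \<in> A. f x = y}"
proof -
  have "A = (\<Union>y\<in>f ` A. {x \<in> A. f x = y})" by auto
  then show thesis
    using assms that by (metis (no_types, lifting) countable_UN)
qed

text \<open>A maximal pairwise disjoint subfamily cannot be countable: it would cover only countably many
  points, each lying in countably many members, so some member would avoid it.\<close>

lemma uncountable_pairwise_disjoint:
  assumes I: "uncountable I" and fin: "\<And>i. i \<in> I \<Longrightarrow> finite (F i)"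
    and pc: "\<And>c. countable {i \<in> I. c \<in> F i}"
  obtains A where "A \<subseteq> I" "uncountable A" "\<And>i j. i \<in> A \<Longrightarrow> j \<in> A \<Longrightarrow> i \<noteq> j \<Longrightarrow> F i \<inter> F j = {}"
proof -
  define D where "D = {A. A \<subseteq> I \<and> (\<forall>i\<in>A. \<forall>j\<in>A. i \<noteq> j \<longrightarrow> F i \<inter> F j = {})}"
  have "\<Union>C \<in> D" if C: "subset.chain D C" for C
  proof -
    have "F i \<inter> F j = {}" if ij: "i \<in> \<Union>C" "j \<in> \<Union>C" "i \<noteq> j" for i j
    proof -
      obtain X Y where "X \<in> C" "Y \<in> C" "i \<in> X" "j \<in> Y" using ij by blast
      moreover have "X \<subseteq> Y \<or> Y \<subseteq> X"
        using C \<open>X \<in> C\<close> \<open>Y \<in> C\<close> by (metis subset_chain_def)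
      moreover have "X \<in> D" "Y \<in> D" using C \<open>X \<in> C\<close> \<open>Y \<in> C\<close> by (auto simp: subset_chain_def)
      ultimately show ?thesis using ij(3) unfolding D_def by blast
    qed
    moreover have "\<Union>C \<subseteq> I" using C by (auto simp: subset_chain_def D_def)
    ultimately show ?thesis by (auto simp: D_def)
  qed
  then obtain M where M: "M \<in> D" and max: "\<And>X. X \<in> D \<Longrightarrow> M \<subseteq> X \<Longrightarrow> X = M"
    using subset_Zorn' by metis
  have "uncountable M"
  proof
    assume cM: "countable M"
    have "countable (\<Union>i\<in>M. F i)"
      using cM M fin by (intro countable_UN) (auto simp: D_def countable_finite)
    then have "countable (M \<union> (\<Union>c\<in>(\<Union>i\<in>M. F i). {i \<in> I. c \<in> F i}))"
      using cM pc by blast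
    then have "\<not> I \<subseteq> M \<union> (\<Union>c\<in>(\<Union>i\<in>M. F i). {i \<in> I. c \<in> F i})"
      using I countable_subset by blast
    then obtain i where i: "i \<in> I" "i \<notin> M" "\<And>j. j \<in> M \<Longrightarrow> F i \<inter> F j = {}"
      by blast
    have "insert i M \<in> D" using M i unfolding D_def by blast
    then show False using max[of "insert i M"] i by blast
  qed
  then show thesis using M that[of M] unfolding D_def by blast
qed

text \<open>Induction on the common cardinality, once it has been made constant: a point lying in uncountably
  many members is put into the root and removed; if there is no such point, an uncountable pairwise
  disjoint subfamily exists and the root is empty.\<close>

lemma delta_system:
  assumes "uncountable I" "\<And>i. i \<in> I \<Longrightarrow> finite (F i)"
  obtains A R where "A \<subseteq> I" "uncountable A" "\<And>i. i \<in> A \<Longrightarrow> R \<subseteq> F i"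
    "\<And>i j. i \<in> A \<Longrightarrow> j \<in> A \<Longrightarrow> i \<noteq> j \<Longrightarrow> F i \<inter> F j = R"
proof -
  have *: "\<exists>A\<subseteq>I. \<exists>R. uncountable A \<and> (\<forall>i\<in>A. R \<subseteq> F i) \<and> (\<forall>i\<in>A. \<forall>j\<in>A. i \<noteq> j \<longrightarrow> F i \<inter> F j = R)"
    if "uncountable I" "\<forall>i\<in>I. finite (F i) \<and> card (F i) = n" for I n and F :: "'a \<Rightarrow> 'b set"
    using that
  proof (induction n arbitrary: I F)
    case 0
    then have "\<forall>i\<in>I. F i = {}" by auto
    then show ?case using "0.prems"(1) by (intro exI[of _ I] conjI exI[of _ "{}"]) auto
  next
    case (Suc n)
    show ?case
    proof (cases "\<exists>c. uncountable {i \<in> I. c \<in> F i}")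
      case True
      then obtain c where c: "uncountable {i \<in> I. c \<in> F i}" by blast
      have "\<forall>i\<in>{i \<in> I. c \<in> F i}. finite (F i - {c}) \<and> card (F i - {c}) = n"
        using Suc.prems(2) by (simp add: card_Diff_singleton)
      from Suc.IH[OF c this] obtain A R where AR: "A \<subseteq> {i \<in> I. c \<in> F i}" "uncountable A"
        "\<forall>i\<in>A. R \<subseteq> F i - {c}" "\<forall>i\<in>A. \<forall>j\<in>A. i \<noteq> j \<longrightarrow> (F i - {c}) \<inter> (F j - {c}) = R"
        by (elim exE conjE) (rule that)
      have "F i \<inter> F j = insert c R" if "i \<in> A" "j \<in> A" "i \<noteq> j" for i j
      proof -
        have "(F i - {c}) \<inter> (F j - {c}) = R" using AR(4) that by simp
        moreover have "c \<in> F i" "c \<in> F j" using AR(1) that by auto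
        ultimately show ?thesis by blast
      qed
      moreover have "insert c R \<subseteq> F i" if "i \<in> A" for i using AR(1,3) that by blast
      moreover have "A \<subseteq> I" using AR(1) by blast
      ultimately show ?thesis using AR(2) by (intro exI[of _ A] conjI exI[of _ "insert c R"]) auto
    next
      case False
      have fin: "\<And>i. i \<in> I \<Longrightarrow> finite (F i)" using Suc.prems(2) by blast
      show ?thesis
      proof (rule uncountable_pairwise_disjoint[OF Suc.prems(1) fin])
        show "countable {i \<in> I. c \<in> F i}" for c using False by simp
      next
        fix A assume "A \<subseteq> I" "uncountable A"
          and disj: "\<And>i j. i \<in> A \<Longrightarrow> j \<in> A \<Longrightarrow> i \<noteq> j \<Longrightarrow> F i \<inter> F j = {}"
        then show ?thesis by (intro exI[of _ A] conjI exI[of _ "{}"]) (simp_all add: disj)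
      qed simp
    qed
  qed
  obtain n where "uncountable {i \<in> I. card (F i) = n}"
    using uncountable_fibre[of I "\<lambda>i. card (F i)"] assms(1) by blast
  then have "\<exists>A\<subseteq>{i \<in> I. card (F i) = n}. \<exists>R. uncountable A \<and> (\<forall>i\<in>A. R \<subseteq> F i)
      \<and> (\<forall>i\<in>A. \<forall>j\<in>A. i \<noteq> j \<longrightarrow> F i \<inter> F j = R)"
    using assms(2) by (intro *[where n = n]) auto
  then obtain A R where "A \<subseteq> {i \<in> I. card (F i) = n}" "uncountable A" "\<forall>i\<in>A. R \<subseteq> F i"
    "\<forall>i\<in>A. \<forall>j\<in>A. i \<noteq> j \<longrightarrow> F i \<inter> F j = R"
    by (elim exE conjE) (rule that)
  then show thesis by (intro that[of A R]) auto
qed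

text \<open>A set of reals that is well-ordered by its usual order is countable, since every element is
  separated from its successor by a rational. The hypothesis is phrased with an auxiliary relation because it
  is applied once to an injection into the reals and once to its negative.\<close>

lemma countable_well_ordered_reals:
  fixes f :: "'a \<Rightarrow> real"
  assumes "wf r" and tot: "\<And>a b. a \<in> A \<Longrightarrow> b \<in> A \<Longrightarrow> a \<noteq> b \<Longrightarrow> (a, b) \<in> r \<or> (b, a) \<in> r"
    and mono: "\<And>a b. a \<in> A \<Longrightarrow> b \<in> A \<Longrightarrow> (a, b) \<in> r \<Longrightarrow> f a < f b"
  shows "countable A"
proof -
  have "\<exists>q\<in>\<rat>. f a < q \<and> (\<forall>b\<in>A. f a < f b \<longrightarrow> q < f b)" for a
  proof (cases "\<exists>b\<in>A. f a < f b")
    case True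
    then obtain b where b: "b \<in> A" "f a < f b"
      and min: "\<And>c. (c, b) \<in> r \<Longrightarrow> \<not> (c \<in> A \<and> f a < f c)"
      using wfE_min[OF \<open>wf r\<close>, of _ "{b \<in> A. f a < f b}"] by (metis (no_types, lifting) mem_Collect_eq)
    obtain q where "q \<in> \<rat>" "f a < q" "q < f b"
      using Rats_dense_in_real b by blast
    moreover have "f b \<le> f c" if "c \<in> A" "f a < f c" for c
      using b min tot mono that by (metis less_eq_real_def)
    ultimately show ?thesis by (meson less_le_trans)
  next
    case False
    obtain q where "q \<in> \<rat>" "f a < q"
      using Rats_dense_in_real[of "f a" "f a + 1"] by auto
    then show ?thesis using False by blast
  qed
  then obtain q where q: "\<And>a. q a \<in> \<rat>" "\<And>a. f a < q a" "\<And>a b. b \<in> A \<Longrightarrow> f a < f b \<Longrightarrow> q a < f b"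
    by metis
  have "inj_on q A"
  proof (rule inj_onI, rule ccontr)
    fix a b assume "a \<in> A" "b \<in> A" "q a = q b" "a \<noteq> b"
    then show False using tot mono q by (metis less_asym)
  qed
  moreover have "countable (q ` A)"
    using q(1) countable_rat by (meson countable_subset image_subsetI)
  ultimately show ?thesis using countable_image_inj_on by blast
qed

text \<open>Compare the cardinality of \<open>\<Gamma>\<close> with the continuum: the smaller of the two injects into the other.\<close>

lemma uncountable_subset_injecting_into_reals:
  assumes "uncountable \<Gamma>"
  obtains G and f :: "'a \<Rightarrow> real" where "G \<subseteq> \<Gamma>" "uncountable G" "inj_on f G"
proof (cases "\<exists>f :: 'a \<Rightarrow> real. inj_on f \<Gamma>")
  case True
  then show thesis using assms that by blast
next
  case False
  then have "\<not> (card_of \<Gamma>, card_of (UNIV :: real set)) \<in> ordLeq"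
    by (metis card_of_ordLeq)
  then have "(card_of (UNIV :: real set), card_of \<Gamma>) \<in> ordLeq"
    by (meson card_of_Well_order ordLeq_total)
  then obtain g :: "real \<Rightarrow> 'a" where g: "inj g" "range g \<subseteq> \<Gamma>"
    by (metis card_of_ordLeq)
  then have "uncountable (range g)"
    using uncountable_UNIV_real countable_image_inj_on by blast
  moreover have "inj_on (inv g) (range g)"
    by (simp add: inj_on_inv_into)
  ultimately show thesis using g that by blast
qed

text \<open>Join two points if a fixed well-order and the order of the reals, transported by an injection,
  agree on them. An uncountable clique would be an uncountable set of reals well-ordered by their
  order, and an uncountable independent set one well-ordered by the reverse order.\<close>

lemma sierpinski_graph:
  assumes "uncountable \<Gamma>"
  obtains G and E :: "'a \<Rightarrow> 'a \<Rightarrow> bool" where "G \<subseteq> \<Gamma>" "uncountable G"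
    "\<And>a b. E a b \<Longrightarrow> a \<noteq> b \<and> a \<in> G \<and> b \<in> G \<and> E b a"
    "\<And>A. A \<subseteq> G \<Longrightarrow> uncountable A \<Longrightarrow> \<exists>a\<in>A. \<exists>b\<in>A. E a b"
    "\<And>A. A \<subseteq> G \<Longrightarrow> uncountable A \<Longrightarrow> \<exists>a\<in>A. \<exists>b\<in>A. a \<noteq> b \<and> \<not> E a b"
proof -
  obtain G and f :: "'a \<Rightarrow> real" where G: "G \<subseteq> \<Gamma>" "uncountable G" "inj_on f G"
    using uncountable_subset_injecting_into_reals assms by blast
  obtain r0 :: "'a rel" where "well_order_on UNIV r0" using well_order_on by blast
  define r where "r = r0 - Id"
  have wf: "wf r" and tot: "\<And>a b. a \<noteq> b \<Longrightarrow> (a, b) \<in> r \<or> (b, a) \<in> r"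
    and asym: "\<And>a b. (a, b) \<in> r \<Longrightarrow> (b, a) \<notin> r"
    using \<open>well_order_on UNIV r0\<close>
    by (auto simp: r_def well_order_on_def linear_order_on_def partial_order_on_def antisym_def total_on_def)
  define E where "E a b \<longleftrightarrow> a \<in> G \<and> b \<in> G \<and> a \<noteq> b \<and> ((a, b) \<in> r \<longleftrightarrow> f a < f b)" for a b
  have Esym: "E b a" if "E a b" for a b
  proof -
    have "f a \<noteq> f b" using that G(3) by (auto simp: E_def inj_on_def)
    moreover have "(a, b) \<in> r \<longleftrightarrow> (b, a) \<notin> r" using that tot asym by (auto simp: E_def)
    ultimately show ?thesis using that by (auto simp: E_def)
  qed
  show thesis
  proof (rule that[OF G(1,2), of E])
    show "a \<noteq> b \<and> a \<in> G \<and> b \<in> G \<and> E b a" if "E a b" for a b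
      using that Esym[OF that] by (simp add: E_def)
  next
    fix A assume A: "A \<subseteq> G" "uncountable A"
    show "\<exists>a\<in>A. \<exists>b\<in>A. E a b"
    proof (rule ccontr)
      assume contra: "\<not> ?thesis"
      then have "- f a < - f b" if "a \<in> A" "b \<in> A" "(a, b) \<in> r" for a b
      proof -
        have "a \<noteq> b" using that(3) asym by blast
        then have "f a \<noteq> f b" using that A(1) G(3) by (auto simp: inj_on_def)
        moreover have "\<not> f a < f b"
          using contra that A(1) \<open>a \<noteq> b\<close> by (auto simp: E_def)
        ultimately show ?thesis by simp
      qed
      then show False
        using countable_well_ordered_reals[OF wf, of A "\<lambda>a. - f a"] tot A(2) by blast
    qed
    show "\<exists>a\<in>A. \<exists>b\<in>A. a \<noteq> b \<and> \<not> E a b"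
    proof (rule ccontr)
      assume contra: "\<not> ?thesis"
      then have "f a < f b" if "a \<in> A" "b \<in> A" "(a, b) \<in> r" for a b
      proof -
        have "a \<noteq> b" using that(3) asym by blast
        then have "E a b" using contra that by blast
        then show ?thesis using that(3) by (simp add: E_def)
      qed
      then show False
        using countable_well_ordered_reals[OF wf, of A f] tot A(2) by blast
    qed
  qed
qed

section \<open>The spaces as normed spaces\<close>

lemma abs_powr_convex:
  fixes p u v a b :: real
  assumes p: "1 < p" and uv: "0 \<le> u" "0 \<le> v" "u + v = 1"
  shows "\<bar>u * a + v * b\<bar> powr p \<le> u * \<bar>a\<bar> powr p + v * \<bar>b\<bar> powr p"
proof -
  have small: "(w * c) powr p \<le> w * c powr p" if "0 \<le> w" "w \<le> 1" "0 \<le> c" for w c :: real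
  proof -
    have "w powr p \<le> w powr 1"
      using that p by (intro powr_mono') auto
    then show ?thesis using that by (simp add: powr_mult mult_right_mono)
  qed
  have "(u * \<bar>a\<bar> + v * \<bar>b\<bar>) powr p \<le> u * \<bar>a\<bar> powr p + v * \<bar>b\<bar> powr p"
  proof (cases "a = 0 \<or> b = 0")
    case True
    then show ?thesis
      using small[of u "\<bar>a\<bar>"] small[of v "\<bar>b\<bar>"] uv p by auto
  next
    case False
    then show ?thesis
    proof -
      have u: "u = 1 - v" using uv by simp
      show ?thesis
        using convex_onD[OF powr_convex[of p], of v "\<bar>a\<bar>" "\<bar>b\<bar>"] uv p False
        unfolding u by simp
    qed
  qed
  moreover have "\<bar>u * a + v * b\<bar> \<le> u * \<bar>a\<bar> + v * \<bar>b\<bar>"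
    using abs_triangle_ineq[of "u * a" "v * b"] uv by (simp add: abs_mult)
  then have "\<bar>u * a + v * b\<bar> powr p \<le> (u * \<bar>a\<bar> + v * \<bar>b\<bar>) powr p"
    using p by (intro powr_mono2) auto
  ultimately show ?thesis by linarith
qed

text \<open>The \<open>p\<close>-th power of the norm. It is additive over disjoint supports, which makes it easier to
  handle than the norm itself.\<close>

definition lp_mass :: "real \<Rightarrow> 'a set \<Rightarrow> ('a \<Rightarrow> real) \<Rightarrow> real" where
  "lp_mass p \<Gamma> x = (\<Sum>\<^sub>\<infinity>\<gamma>\<in>\<Gamma>. \<bar>x \<gamma>\<bar> powr p)"

lemma lp_mass_nonneg: "0 \<le> lp_mass p \<Gamma> x"
  unfolding lp_mass_def by (intro infsum_nonneg) auto

lemma lp_norm_nonneg: "0 \<le> lp_norm p \<Gamma> x"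
  unfolding lp_norm_def by simp

lemma lp_norm_minus: "lp_norm p \<Gamma> (\<lambda>\<gamma>. - x \<gamma>) = lp_norm p \<Gamma> x"
  unfolding lp_norm_def by simp

lemma lp_norm_le_iff:
  assumes "1 < p" "0 \<le> c"
  shows "lp_norm p \<Gamma> x \<le> c \<longleftrightarrow> lp_mass p \<Gamma> x \<le> c powr p"
proof -
  have *: "lp_norm p \<Gamma> x = lp_mass p \<Gamma> x powr (1 / p)"
    by (simp add: lp_norm_def lp_mass_def)
  show ?thesis
  proof
    assume "lp_norm p \<Gamma> x \<le> c"
    then have "(lp_mass p \<Gamma> x powr (1 / p)) powr p \<le> c powr p"
      using assms unfolding * by (intro powr_mono2) auto
    then show "lp_mass p \<Gamma> x \<le> c powr p"
      using assms lp_mass_nonneg[of p \<Gamma> x] by (simp add: powr_powr)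
  next
    assume "lp_mass p \<Gamma> x \<le> c powr p"
    then have "lp_mass p \<Gamma> x powr (1 / p) \<le> (c powr p) powr (1 / p)"
      using assms lp_mass_nonneg[of p \<Gamma> x] by (intro powr_mono2) auto
    then show "lp_norm p \<Gamma> x \<le> c"
      using assms unfolding * by (simp add: powr_powr)
  qed
qed

lemma finite_sum_le_lp_mass:
  assumes "x \<in> lp_space p \<Gamma>" "finite K" "K \<subseteq> \<Gamma>"
  shows "(\<Sum>\<gamma>\<in>K. \<bar>x \<gamma>\<bar> powr p) \<le> lp_mass p \<Gamma> x"
  using assms unfolding lp_mass_def lp_space_def by (intro finite_sum_le_infsum) auto

lemma abs_le_lp_norm:
  assumes "1 < p" "x \<in> lp_space p \<Gamma>"
  shows "\<bar>x \<gamma>\<bar> \<le> lp_norm p \<Gamma> x"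
proof (cases "\<gamma> \<in> \<Gamma>")
  case True
  have "lp_mass p \<Gamma> x \<le> lp_norm p \<Gamma> x powr p"
    using lp_norm_le_iff[OF assms(1) lp_norm_nonneg] by blast
  then have "\<bar>x \<gamma>\<bar> powr p \<le> lp_norm p \<Gamma> x powr p"
    using finite_sum_le_lp_mass[of x p \<Gamma> "{\<gamma>}"] True assms by simp
  then show ?thesis
    using assms lp_norm_nonneg[of p \<Gamma> x] powr_less_mono2[of p "lp_norm p \<Gamma> x" "\<bar>x \<gamma>\<bar>"] by force
next
  case False
  then show ?thesis using assms lp_norm_nonneg[of p \<Gamma> x] by (simp add: lp_space_def)
qed

lemma lp_finite_support:
  assumes "finite K" "K \<subseteq> \<Gamma>" "\<And>\<gamma>. \<gamma> \<notin> K \<Longrightarrow> x \<gamma> = 0"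
  shows "x \<in> lp_space p \<Gamma>" "lp_mass p \<Gamma> x = (\<Sum>\<gamma>\<in>K. \<bar>x \<gamma>\<bar> powr p)"
proof -
  have "((\<lambda>\<gamma>. \<bar>x \<gamma>\<bar> powr p) has_sum (\<Sum>\<gamma>\<in>K. \<bar>x \<gamma>\<bar> powr p)) K"
    using assms by simp
  moreover have "((\<lambda>\<gamma>. \<bar>x \<gamma>\<bar> powr p) has_sum s) K \<longleftrightarrow> ((\<lambda>\<gamma>. \<bar>x \<gamma>\<bar> powr p) has_sum s) \<Gamma>" for s
    by (rule has_sum_cong_neutral) (use assms in auto)
  ultimately have *: "((\<lambda>\<gamma>. \<bar>x \<gamma>\<bar> powr p) has_sum (\<Sum>\<gamma>\<in>K. \<bar>x \<gamma>\<bar> powr p)) \<Gamma>"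
    by simp
  then show "lp_mass p \<Gamma> x = (\<Sum>\<gamma>\<in>K. \<bar>x \<gamma>\<bar> powr p)"
    unfolding lp_mass_def by (rule infsumI)
  show "x \<in> lp_space p \<Gamma>"
    using * assms by (auto simp: lp_space_def summable_on_def)
qed

lemma lp_scale:
  assumes "1 < p" "x \<in> lp_space p \<Gamma>"
  shows "(\<lambda>\<gamma>. c * x \<gamma>) \<in> lp_space p \<Gamma>" "lp_norm p \<Gamma> (\<lambda>\<gamma>. c * x \<gamma>) = \<bar>c\<bar> * lp_norm p \<Gamma> x"
proof -
  have *: "\<bar>c * x \<gamma>\<bar> powr p = \<bar>c\<bar> powr p * \<bar>x \<gamma>\<bar> powr p" for \<gamma>
    by (simp add: abs_mult powr_mult)
  show "(\<lambda>\<gamma>. c * x \<gamma>) \<in> lp_space p \<Gamma>"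
    using assms by (simp add: lp_space_def * summable_on_cmult_right)
  show "lp_norm p \<Gamma> (\<lambda>\<gamma>. c * x \<gamma>) = \<bar>c\<bar> * lp_norm p \<Gamma> x"
    unfolding lp_norm_def * infsum_cmult_right'
    using assms by (simp add: powr_mult powr_powr infsum_nonneg)
qed

text \<open>Minkowski's inequality, by convexity of the \<open>p\<close>-th power: \<open>x + y\<close> is \<open>s + t\<close> times a convex
  combination of \<open>x / s\<close> and \<open>y / t\<close>. Strictly positive upper bounds \<open>s\<close> and \<open>t\<close>, in place of the norms,
  avoid a case distinction for zero vectors.\<close>

lemma lp_mass_add_le:
  assumes p: "1 < p" and x: "x \<in> lp_space p \<Gamma>" "lp_mass p \<Gamma> x \<le> s powr p" "0 < s"
    and y: "y \<in> lp_space p \<Gamma>" "lp_mass p \<Gamma> y \<le> t powr p" "0 < t"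
  shows "(\<lambda>\<gamma>. x \<gamma> + y \<gamma>) \<in> lp_space p \<Gamma>"
    and "lp_mass p \<Gamma> (\<lambda>\<gamma>. x \<gamma> + y \<gamma>) \<le> (s + t) powr p"
proof -
  define u v where "u = s / (s + t)" and "v = t / (s + t)"
  define A B where "A = u * ((s + t) / s) powr p" and "B = v * ((s + t) / t) powr p"
  have uv: "0 \<le> u" "0 \<le> v" "u + v = 1"
    using \<open>0 < s\<close> \<open>0 < t\<close> by (auto simp: u_def v_def simp flip: add_divide_distrib)
  have AB: "0 \<le> A" "0 \<le> B" using uv by (auto simp: A_def B_def)
  have pt: "\<bar>x \<gamma> + y \<gamma>\<bar> powr p \<le> A * \<bar>x \<gamma>\<bar> powr p + B * \<bar>y \<gamma>\<bar> powr p" for \<gamma>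
  proof -
    have "u * ((s + t) / s * x \<gamma>) + v * ((s + t) / t * y \<gamma>) = x \<gamma> + y \<gamma>"
      using \<open>0 < s\<close> \<open>0 < t\<close> by (simp add: u_def v_def)
    then have "\<bar>x \<gamma> + y \<gamma>\<bar> powr p
        \<le> u * \<bar>(s + t) / s * x \<gamma>\<bar> powr p + v * \<bar>(s + t) / t * y \<gamma>\<bar> powr p"
      using abs_powr_convex[OF p uv, of "(s + t) / s * x \<gamma>" "(s + t) / t * y \<gamma>"] by simp
    also have "\<dots> = A * \<bar>x \<gamma>\<bar> powr p + B * \<bar>y \<gamma>\<bar> powr p"
    proof -
      have "\<bar>k * a\<bar> powr p = k powr p * \<bar>a\<bar> powr p" if "0 \<le> k" for k a :: real
        using that by (simp add: abs_mult powr_mult)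
      moreover have "0 \<le> (s + t) / s" "0 \<le> (s + t) / t" using \<open>0 < s\<close> \<open>0 < t\<close> by auto
      ultimately show ?thesis by (simp only: A_def B_def mult.assoc)
    qed
    finally show ?thesis .
  qed
  have sx: "(\<lambda>\<gamma>. \<bar>x \<gamma>\<bar> powr p) summable_on \<Gamma>" and sy: "(\<lambda>\<gamma>. \<bar>y \<gamma>\<bar> powr p) summable_on \<Gamma>"
    using x y by (auto simp: lp_space_def)
  have sAB: "(\<lambda>\<gamma>. A * \<bar>x \<gamma>\<bar> powr p + B * \<bar>y \<gamma>\<bar> powr p) summable_on \<Gamma>"
    using sx sy by (intro summable_on_add summable_on_cmult_right)
  have s: "(\<lambda>\<gamma>. \<bar>x \<gamma> + y \<gamma>\<bar> powr p) summable_on \<Gamma>"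
    by (rule summable_on_comparison_test[OF sAB pt]) simp
  then show "(\<lambda>\<gamma>. x \<gamma> + y \<gamma>) \<in> lp_space p \<Gamma>"
    using x y by (auto simp: lp_space_def)
  have "lp_mass p \<Gamma> (\<lambda>\<gamma>. x \<gamma> + y \<gamma>) \<le> (\<Sum>\<^sub>\<infinity>\<gamma>\<in>\<Gamma>. A * \<bar>x \<gamma>\<bar> powr p + B * \<bar>y \<gamma>\<bar> powr p)"
    unfolding lp_mass_def by (rule infsum_mono[OF s sAB pt])
  also have "\<dots> = A * lp_mass p \<Gamma> x + B * lp_mass p \<Gamma> y"
    unfolding lp_mass_def using sx sy
    by (subst infsum_add) (auto intro: summable_on_cmult_right simp: infsum_cmult_right')
  also have "\<dots> \<le> A * s powr p + B * t powr p"
    using x y AB by (intro add_mono mult_left_mono) auto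
  also have "\<dots> = (u + v) * (s + t) powr p"
    using \<open>0 < s\<close> \<open>0 < t\<close> by (simp add: A_def B_def powr_divide algebra_simps)
  finally show "lp_mass p \<Gamma> (\<lambda>\<gamma>. x \<gamma> + y \<gamma>) \<le> (s + t) powr p" using uv by simp
qed

lemma lp_add:
  assumes p: "1 < p" and x: "x \<in> lp_space p \<Gamma>" and y: "y \<in> lp_space p \<Gamma>"
  shows "(\<lambda>\<gamma>. x \<gamma> + y \<gamma>) \<in> lp_space p \<Gamma>"
    and "lp_norm p \<Gamma> (\<lambda>\<gamma>. x \<gamma> + y \<gamma>) \<le> lp_norm p \<Gamma> x + lp_norm p \<Gamma> y"
proof -
  have mass: "lp_mass p \<Gamma> z \<le> (lp_norm p \<Gamma> z + e) powr p" if "0 < e" for z e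
    using lp_norm_le_iff[OF p, of "lp_norm p \<Gamma> z + e" \<Gamma> z] lp_norm_nonneg[of p \<Gamma> z] that by simp
  have pos: "0 < lp_norm p \<Gamma> z + e" if "0 < e" for z e
    using lp_norm_nonneg[of p \<Gamma> z] that by linarith
  note add = lp_mass_add_le[OF p x mass pos y mass pos]
  show "(\<lambda>\<gamma>. x \<gamma> + y \<gamma>) \<in> lp_space p \<Gamma>" by (rule add(1)[of 1 1]) auto
  show "lp_norm p \<Gamma> (\<lambda>\<gamma>. x \<gamma> + y \<gamma>) \<le> lp_norm p \<Gamma> x + lp_norm p \<Gamma> y"
  proof (rule field_le_epsilon)
    fix e :: real assume "0 < e"
    then have "lp_norm p \<Gamma> (\<lambda>\<gamma>. x \<gamma> + y \<gamma>) \<le> (lp_norm p \<Gamma> x + e / 2) + (lp_norm p \<Gamma> y + e / 2)"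
      using add(2)[of "e / 2" "e / 2"] pos[of "e / 2" x] pos[of "e / 2" y]
      by (subst lp_norm_le_iff[OF p]) auto
    then show "lp_norm p \<Gamma> (\<lambda>\<gamma>. x \<gamma> + y \<gamma>) \<le> lp_norm p \<Gamma> x + lp_norm p \<Gamma> y + e" by simp
  qed
qed

lemma lp_diff:
  assumes "1 < p" "x \<in> lp_space p \<Gamma>" "y \<in> lp_space p \<Gamma>"
  shows "(\<lambda>\<gamma>. x \<gamma> - y \<gamma>) \<in> lp_space p \<Gamma>"
    and "lp_norm p \<Gamma> (\<lambda>\<gamma>. x \<gamma> - y \<gamma>) \<le> lp_norm p \<Gamma> x + lp_norm p \<Gamma> y"
  using lp_add[OF assms(1,2) lp_scale(1)[OF assms(1,3), of "-1"]]
  by (simp_all add: lp_norm_minus)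

lemma is_norm_on_lp_norm:
  assumes "1 < p"
  shows "is_norm_on (lp_space p \<Gamma>) (lp_norm p \<Gamma>)"
  unfolding is_norm_on_def
proof (intro conjI ballI allI)
  fix x assume x: "x \<in> lp_space p \<Gamma>"
  have "x = (\<lambda>\<gamma>. 0)" if "lp_norm p \<Gamma> x = 0"
    using abs_le_lp_norm[OF assms x] that by auto
  moreover have "lp_norm p \<Gamma> (\<lambda>\<gamma>. 0) = 0"
    using assms by (simp add: lp_norm_def)
  ultimately show "lp_norm p \<Gamma> x = 0 \<longleftrightarrow> x = (\<lambda>\<gamma>. 0)" by blast
qed (use assms in \<open>auto simp: lp_norm_nonneg lp_scale lp_add\<close>)

lemma lp_truncate:
  assumes p: "1 < p" and x: "x \<in> lp_space p \<Gamma>" and e: "0 < e"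
  obtains K where "finite K" "K \<subseteq> \<Gamma>"
    "lp_norm p \<Gamma> (\<lambda>\<gamma>. x \<gamma> - (if \<gamma> \<in> K then x \<gamma> else 0)) \<le> e"
proof -
  have s: "(\<lambda>\<gamma>. \<bar>x \<gamma>\<bar> powr p) summable_on \<Gamma>" using x by (auto simp: lp_space_def)
  then have "((\<lambda>\<gamma>. \<bar>x \<gamma>\<bar> powr p) has_sum lp_mass p \<Gamma> x) \<Gamma>"
    unfolding lp_mass_def by simp
  then obtain K where K: "finite K" "K \<subseteq> \<Gamma>"
    "dist (\<Sum>\<gamma>\<in>K. \<bar>x \<gamma>\<bar> powr p) (lp_mass p \<Gamma> x) \<le> e powr p"
    using has_sum_finite_approximation[where \<epsilon> = "e powr p"] e by (metis powr_gt_zero less_irrefl)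
  have sub: "(\<lambda>\<gamma>. \<bar>x \<gamma>\<bar> powr p) summable_on (\<Gamma> - K)"
    using s by (rule summable_on_subset_banach) auto
  have "lp_mass p \<Gamma> x = infsum (\<lambda>\<gamma>. \<bar>x \<gamma>\<bar> powr p) (K \<union> (\<Gamma> - K))"
    unfolding lp_mass_def using K by (simp add: Un_absorb1)
  also have "\<dots> = (\<Sum>\<gamma>\<in>K. \<bar>x \<gamma>\<bar> powr p) + infsum (\<lambda>\<gamma>. \<bar>x \<gamma>\<bar> powr p) (\<Gamma> - K)"
    using K sub by (subst infsum_Un_disjoint) auto
  finally have "infsum (\<lambda>\<gamma>. \<bar>x \<gamma>\<bar> powr p) (\<Gamma> - K) \<le> e powr p"
    using K(3) by (simp add: dist_real_def)
  moreover have "lp_mass p \<Gamma> (\<lambda>\<gamma>. x \<gamma> - (if \<gamma> \<in> K then x \<gamma> else 0)) = infsum (\<lambda>\<gamma>. \<bar>x \<gamma>\<bar> powr p) (\<Gamma> - K)"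
    unfolding lp_mass_def using p by (intro infsum_cong_neutral) auto
  ultimately have "lp_norm p \<Gamma> (\<lambda>\<gamma>. x \<gamma> - (if \<gamma> \<in> K then x \<gamma> else 0)) \<le> e"
    using lp_norm_le_iff[OF p less_imp_le[OF e]] by metis
  then show thesis by (rule that[OF K(1,2)])
qed

text \<open>The metric axioms demand nonnegativity and symmetry at all pairs of points, also outside the
  carrier, so these two properties are imposed on all functions and not only on \<open>lp_space p \<Gamma>\<close>.\<close>

definition everywhere_even_norm :: "real \<Rightarrow> 'a set \<Rightarrow> (('a \<Rightarrow> real) \<Rightarrow> real) \<Rightarrow> bool" where
  "everywhere_even_norm p \<Gamma> N \<longleftrightarrow>
     is_norm_on (lp_space p \<Gamma>) N \<and> (\<forall>x. 0 \<le> N x) \<and> (\<forall>x. N (\<lambda>\<gamma>. - x \<gamma>) = N x)"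

lemma everywhere_even_norm_lp_norm: "1 < p \<Longrightarrow> everywhere_even_norm p \<Gamma> (lp_norm p \<Gamma>)"
  by (simp add: everywhere_even_norm_def is_norm_on_lp_norm lp_norm_nonneg lp_norm_minus)

lemma Metric_space_lp:
  assumes "1 < p" and N: "everywhere_even_norm p \<Gamma> N"
  shows "Metric_space (lp_space p \<Gamma>) (\<lambda>x y. N (\<lambda>\<gamma>. x \<gamma> - y \<gamma>))"
proof
  fix x y z
  show "0 \<le> N (\<lambda>\<gamma>. x \<gamma> - y \<gamma>)" using N by (simp add: everywhere_even_norm_def)
  have "\<forall>x. N (\<lambda>\<gamma>. - x \<gamma>) = N x"
    using N by (simp add: everywhere_even_norm_def)
  from this[rule_format, of "\<lambda>\<gamma>. x \<gamma> - y \<gamma>"]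
  show "N (\<lambda>\<gamma>. x \<gamma> - y \<gamma>) = N (\<lambda>\<gamma>. y \<gamma> - x \<gamma>)" by simp
  have norm: "is_norm_on (lp_space p \<Gamma>) N" using N by (simp add: everywhere_even_norm_def)
  assume x: "x \<in> lp_space p \<Gamma>" and y: "y \<in> lp_space p \<Gamma>"
  have "N (\<lambda>\<gamma>. x \<gamma> - y \<gamma>) = 0 \<longleftrightarrow> (\<lambda>\<gamma>. x \<gamma> - y \<gamma>) = (\<lambda>\<gamma>. 0)"
    using norm lp_diff(1)[OF \<open>1 < p\<close> x y] by (simp add: is_norm_on_def)
  then show "N (\<lambda>\<gamma>. x \<gamma> - y \<gamma>) = 0 \<longleftrightarrow> x = y"
    by (simp add: fun_eq_iff)
  assume z: "z \<in> lp_space p \<Gamma>"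
  have "N (\<lambda>\<gamma>. a \<gamma> + b \<gamma>) \<le> N a + N b" if "a \<in> lp_space p \<Gamma>" "b \<in> lp_space p \<Gamma>" for a b
    using norm that by (simp add: is_norm_on_def)
  from this[OF lp_diff(1)[OF \<open>1 < p\<close> x y] lp_diff(1)[OF \<open>1 < p\<close> y z]]
  show "N (\<lambda>\<gamma>. x \<gamma> - z \<gamma>) \<le> N (\<lambda>\<gamma>. x \<gamma> - y \<gamma>) + N (\<lambda>\<gamma>. y \<gamma> - z \<gamma>)" by simp
qed

lemma openin_norm_topology_lp:
  assumes "1 < p" "everywhere_even_norm p \<Gamma> N"
  shows "openin (norm_topology (lp_space p \<Gamma>) N) U \<longleftrightarrow> U \<subseteq> lp_space p \<Gamma> \<and>
    (\<forall>x\<in>U. \<exists>r>0. \<forall>y\<in>lp_space p \<Gamma>. N (\<lambda>\<gamma>. x \<gamma> - y \<gamma>) < r \<longrightarrow> y \<in> U)"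
proof -
  note ms = Metric_space_lp[OF assms]
  show ?thesis
    unfolding norm_topology_def Metric_space.openin_mtopology[OF ms] subset_iff Metric_space.in_mball[OF ms]
    by blast
qed

lemma topspace_norm_topology_lp:
  assumes "1 < p" "everywhere_even_norm p \<Gamma> N"
  shows "topspace (norm_topology (lp_space p \<Gamma>) N) = lp_space p \<Gamma>"
  unfolding norm_topology_def by (rule Metric_space.topspace_mtopology[OF Metric_space_lp[OF assms]])

lemma norm_topology_finer:
  assumes p: "1 < p" and N: "everywhere_even_norm p \<Gamma> N" and M: "everywhere_even_norm p \<Gamma> M"
    and c: "0 < c" "\<And>x. x \<in> lp_space p \<Gamma> \<Longrightarrow> N x \<le> c * M x"
    and U: "openin (norm_topology (lp_space p \<Gamma>) N) U"
  shows "openin (norm_topology (lp_space p \<Gamma>) M) U"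
  unfolding openin_norm_topology_lp[OF p M]
proof (intro conjI ballI)
  note op = U[unfolded openin_norm_topology_lp[OF p N]]
  then show sub: "U \<subseteq> lp_space p \<Gamma>" by blast
  fix x assume x: "x \<in> U"
  obtain r where r: "0 < r" "\<And>y. y \<in> lp_space p \<Gamma> \<Longrightarrow> N (\<lambda>\<gamma>. x \<gamma> - y \<gamma>) < r \<Longrightarrow> y \<in> U"
    using op x by blast
  have "y \<in> U" if y: "y \<in> lp_space p \<Gamma>" "M (\<lambda>\<gamma>. x \<gamma> - y \<gamma>) < r / c" for y
  proof (rule r(2)[OF y(1)])
    have "N (\<lambda>\<gamma>. x \<gamma> - y \<gamma>) \<le> c * M (\<lambda>\<gamma>. x \<gamma> - y \<gamma>)"
      using c(2)[OF lp_diff(1)[OF p, of x \<Gamma> y]] x y sub by blast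
    then show "N (\<lambda>\<gamma>. x \<gamma> - y \<gamma>) < r"
      using y(2) c(1) by (simp add: field_simps)
  qed
  then show "\<exists>s>0. \<forall>y\<in>lp_space p \<Gamma>. M (\<lambda>\<gamma>. x \<gamma> - y \<gamma>) < s \<longrightarrow> y \<in> U"
    using r(1) c(1) by (intro exI[of _ "r / c"]) auto
qed

lemma equivalent_norms_on_lpI:
  assumes "1 < p" "everywhere_even_norm p \<Gamma> N" "everywhere_even_norm p \<Gamma> M"
    and "0 < c" "\<And>x. x \<in> lp_space p \<Gamma> \<Longrightarrow> N x \<le> c * M x" "\<And>x. x \<in> lp_space p \<Gamma> \<Longrightarrow> M x \<le> c * N x"
  shows "equivalent_norms_on (lp_space p \<Gamma>) N M"
  unfolding equivalent_norms_on_def topology_eq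
  using norm_topology_finer[OF assms(1,2,3,4,5)] norm_topology_finer[OF assms(1,3,2,4,6)] by blast

section \<open>The weak topology on bounded sets\<close>

abbreviation lp_dual :: "real \<Rightarrow> 'a set \<Rightarrow> (('a \<Rightarrow> real) \<Rightarrow> real) set" where
  "lp_dual p \<Gamma> \<equiv> continuous_dual (lp_space p \<Gamma>) (lp_norm p \<Gamma>)"

lemma lp_dual_add:
  assumes "f \<in> lp_dual p \<Gamma>" "x \<in> lp_space p \<Gamma>" "y \<in> lp_space p \<Gamma>"
  shows "f (\<lambda>\<gamma>. x \<gamma> + y \<gamma>) = f x + f y"
  using assms by (simp add: continuous_dual_def)

lemma lp_dual_scale:
  assumes "f \<in> lp_dual p \<Gamma>" "x \<in> lp_space p \<Gamma>"
  shows "f (\<lambda>\<gamma>. c * x \<gamma>) = c * f x"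
  using assms by (simp add: continuous_dual_def)

lemma lp_dual_diff:
  assumes "1 < p" "f \<in> lp_dual p \<Gamma>" "x \<in> lp_space p \<Gamma>" "y \<in> lp_space p \<Gamma>"
  shows "f (\<lambda>\<gamma>. x \<gamma> - y \<gamma>) = f x - f y"
  using lp_dual_add[OF assms(2,3) lp_scale(1)[OF assms(1,4), of "-1"]]
    lp_dual_scale[OF assms(2,4), of "-1"] by simp

lemma lp_dual_bounded:
  assumes p: "1 < p" and f: "f \<in> lp_dual p \<Gamma>"
  obtains C where "0 < C" "\<And>x. x \<in> lp_space p \<Gamma> \<Longrightarrow> \<bar>f x\<bar> \<le> C * lp_norm p \<Gamma> x"
proof -
  note en = everywhere_even_norm_lp_norm[OF p, of \<Gamma>]
  have zero: "(\<lambda>\<gamma>. 0) \<in> lp_space p \<Gamma>" by (simp add: lp_space_def)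
  have f0: "f (\<lambda>\<gamma>. 0) = 0" using lp_dual_scale[OF f zero, of 0] by simp
  have "continuous_map (norm_topology (lp_space p \<Gamma>) (lp_norm p \<Gamma>)) euclideanreal f"
    using f by (simp add: continuous_dual_def)
  from openin_continuous_map_preimage[OF this, of "{-1<..<1}"]
  have "openin (norm_topology (lp_space p \<Gamma>) (lp_norm p \<Gamma>)) {x \<in> lp_space p \<Gamma>. f x \<in> {-1<..<1}}"
    unfolding topspace_norm_topology_lp[OF p en] by (simp flip: open_openin)
  moreover have "(\<lambda>\<gamma>. 0) \<in> {x \<in> lp_space p \<Gamma>. f x \<in> {-1<..<1}}" using zero f0 by simp
  ultimately have "\<exists>r>0. \<forall>y\<in>lp_space p \<Gamma>. lp_norm p \<Gamma> (\<lambda>\<gamma>. 0 - y \<gamma>) < r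
      \<longrightarrow> y \<in> {x \<in> lp_space p \<Gamma>. f x \<in> {-1<..<1}}"
    unfolding openin_norm_topology_lp[OF p en] by (elim conjE bspec)
  then obtain r where r: "0 < r"
    "\<And>y. y \<in> lp_space p \<Gamma> \<Longrightarrow> lp_norm p \<Gamma> (\<lambda>\<gamma>. 0 - y \<gamma>) < r \<Longrightarrow> f y \<in> {-1<..<1}"
    by blast
  have bd: "\<bar>f x\<bar> \<le> 2 / r * lp_norm p \<Gamma> x" if x: "x \<in> lp_space p \<Gamma>" for x
  proof (cases "lp_norm p \<Gamma> x = 0")
    case True
    then have "x = (\<lambda>\<gamma>. 0)" using is_norm_on_lp_norm[OF p] x unfolding is_norm_on_def by blast
    then show ?thesis using f0 True by simp
  next
    case False
    then have pos: "0 < lp_norm p \<Gamma> x" using lp_norm_nonneg[of p \<Gamma> x] by simp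
    define c where "c = r / (2 * lp_norm p \<Gamma> x)"
    have c: "0 < c" using pos r by (simp add: c_def)
    have "lp_norm p \<Gamma> (\<lambda>\<gamma>. 0 - c * x \<gamma>) < r"
      using lp_scale(2)[OF p x, of c] lp_norm_minus[of p \<Gamma> "\<lambda>\<gamma>. c * x \<gamma>"] c pos r
      by (simp add: c_def)
    then have "f (\<lambda>\<gamma>. c * x \<gamma>) \<in> {-1<..<1}"
      using r(2) lp_scale(1)[OF p x] by blast
    then have "\<bar>c * f x\<bar> < 1" using lp_dual_scale[OF f x, of c] by auto
    then have "c * \<bar>f x\<bar> < 1" using c by (simp add: abs_mult)
    then show ?thesis using c pos r by (simp add: c_def field_simps)
  qed
  show thesis by (rule that[of "2 / r"]) (use bd r in auto)
qed

lemma lp_restrict: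
  assumes p: "1 < p" and x: "x \<in> lp_space p \<Gamma>"
  shows "(\<lambda>\<gamma>. if \<gamma> \<in> K then x \<gamma> else 0) \<in> lp_space p \<Gamma>"
    and "lp_mass p \<Gamma> (\<lambda>\<gamma>. if \<gamma> \<in> K then x \<gamma> else 0) \<le> lp_mass p \<Gamma> x"
    and "lp_norm p \<Gamma> (\<lambda>\<gamma>. if \<gamma> \<in> K then x \<gamma> else 0) \<le> lp_norm p \<Gamma> x"
proof -
  have s: "(\<lambda>\<gamma>. \<bar>x \<gamma>\<bar> powr p) summable_on \<Gamma>" using x by (simp add: lp_space_def)
  have le: "\<bar>if \<gamma> \<in> K then x \<gamma> else 0\<bar> powr p \<le> \<bar>x \<gamma>\<bar> powr p" for \<gamma> by simp
  have s': "(\<lambda>\<gamma>. \<bar>if \<gamma> \<in> K then x \<gamma> else 0\<bar> powr p) summable_on \<Gamma>"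
    by (rule summable_on_comparison_test[OF s le]) simp
  then show "(\<lambda>\<gamma>. if \<gamma> \<in> K then x \<gamma> else 0) \<in> lp_space p \<Gamma>"
    using x by (simp add: lp_space_def)
  show *: "lp_mass p \<Gamma> (\<lambda>\<gamma>. if \<gamma> \<in> K then x \<gamma> else 0) \<le> lp_mass p \<Gamma> x"
    unfolding lp_mass_def by (rule infsum_mono[OF s' s le])
  show "lp_norm p \<Gamma> (\<lambda>\<gamma>. if \<gamma> \<in> K then x \<gamma> else 0) \<le> lp_norm p \<Gamma> x"
    using * lp_norm_le_iff[OF p lp_norm_nonneg] by (meson order_trans order_refl)
qed

text \<open>Here \<open>1 < p\<close> is essential, since the statement fails for \<open>p = 1\<close> and the sum of all
  coordinates. No representation of functionals is needed: if \<open>f\<close> exceeded \<open>e\<close> off every finite set, one could choose \<open>n\<close> finitely supported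
  vectors of norm at most \<open>M\<close> with disjoint supports on which \<open>f\<close> is at least \<open>e / 2\<close>. Their sum has
  norm at most \<open>n powr (1 / p) * M\<close> while \<open>f\<close> is at least \<open>n * (e / 2)\<close> there, which contradicts boundedness
  for large \<open>n\<close>.\<close>

lemma lp_dual_small_off_finite:
  assumes p: "1 < p" and f: "f \<in> lp_dual p \<Gamma>" and e: "0 < e" and M: "0 < M"
  obtains F where "finite F" "F \<subseteq> \<Gamma>"
    "\<And>z. z \<in> lp_space p \<Gamma> \<Longrightarrow> lp_norm p \<Gamma> z \<le> M \<Longrightarrow> (\<And>\<gamma>. \<gamma> \<in> F \<Longrightarrow> z \<gamma> = 0) \<Longrightarrow> \<bar>f z\<bar> \<le> e"
proof (rule ccontr)
  assume contra: "\<not> thesis"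
  note witness = that
  obtain C where C: "0 < C" "\<And>x. x \<in> lp_space p \<Gamma> \<Longrightarrow> \<bar>f x\<bar> \<le> C * lp_norm p \<Gamma> x"
    using lp_dual_bounded[OF p f] by blast
  \<comment> \<open>truncating a vector on which \<open>f\<close> exceeds \<open>e\<close> costs at most half of the value\<close>
  have block: "\<exists>z L. finite L \<and> L \<subseteq> \<Gamma> \<and> L \<inter> F = {} \<and> (\<forall>\<gamma>. \<gamma> \<notin> L \<longrightarrow> z \<gamma> = 0)
      \<and> lp_mass p \<Gamma> z \<le> M powr p \<and> e / 2 \<le> f z"
    if F: "finite F" "F \<subseteq> \<Gamma>" for F
  proof -
    have "\<not> (\<forall>z. z \<in> lp_space p \<Gamma> \<and> lp_norm p \<Gamma> z \<le> M \<and> (\<forall>\<gamma>\<in>F. z \<gamma> = 0) \<longrightarrow> \<bar>f z\<bar> \<le> e)"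
      using contra witness[OF F] by blast
    then obtain z0 where z0: "z0 \<in> lp_space p \<Gamma>" "lp_norm p \<Gamma> z0 \<le> M"
      "\<And>\<gamma>. \<gamma> \<in> F \<Longrightarrow> z0 \<gamma> = 0" "e < \<bar>f z0\<bar>"
      by (auto simp: not_le)
    define c :: real where "c = (if 0 \<le> f z0 then 1 else -1)"
    define z where "z = (\<lambda>\<gamma>. c * z0 \<gamma>)"
    have z: "z \<in> lp_space p \<Gamma>" "lp_norm p \<Gamma> z \<le> M" "\<And>\<gamma>. \<gamma> \<in> F \<Longrightarrow> z \<gamma> = 0" "e < f z"
      unfolding z_def using z0 lp_scale[OF p z0(1), of c] lp_dual_scale[OF f z0(1), of c]
      by (auto simp: c_def)
    obtain L0 where L0: "finite L0" "L0 \<subseteq> \<Gamma>"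
      "lp_norm p \<Gamma> (\<lambda>\<gamma>. z \<gamma> - (if \<gamma> \<in> L0 then z \<gamma> else 0)) \<le> e / (2 * C)"
      using lp_truncate[OF p z(1), of "e / (2 * C)"] e C by auto
    define w where "w = (\<lambda>\<gamma>. if \<gamma> \<in> L0 then z \<gamma> else 0)"
    have w: "w \<in> lp_space p \<Gamma>" "lp_mass p \<Gamma> w \<le> lp_mass p \<Gamma> z"
      unfolding w_def by (rule lp_restrict[OF p z(1)])+
    have "\<bar>f (\<lambda>\<gamma>. z \<gamma> - w \<gamma>)\<bar> \<le> C * (e / (2 * C))"
      using C(2)[OF lp_diff(1)[OF p z(1) w(1)]] L0(3) C(1) unfolding w_def
      by (meson mult_left_mono order_trans less_imp_le)
    then have "\<bar>f z - f w\<bar> \<le> e / 2" using lp_dual_diff[OF p f z(1) w(1)] C(1) by simp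
    then have "e / 2 \<le> f w" using z(4) by linarith
    moreover have "lp_mass p \<Gamma> w \<le> M powr p"
      using w(2) z(2) lp_norm_le_iff[OF p less_imp_le[OF M]] by (meson order_trans)
    moreover have "\<gamma> \<notin> L0 - F \<longrightarrow> w \<gamma> = 0" for \<gamma> using z(3) by (simp add: w_def)
    ultimately show ?thesis using L0 by (intro exI[of _ w] exI[of _ "L0 - F"]) auto
  qed
  have chain: "\<exists>w K. finite K \<and> K \<subseteq> \<Gamma> \<and> (\<forall>\<gamma>. \<gamma> \<notin> K \<longrightarrow> w \<gamma> = 0)
      \<and> lp_mass p \<Gamma> w \<le> real n * M powr p \<and> real n * (e / 2) \<le> f w" for n
  proof (induction n)
    case 0
    have "f (\<lambda>\<gamma>. 0) = 0"
      using lp_dual_scale[OF f, of "\<lambda>\<gamma>. 0" 0] by (simp add: lp_space_def)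
    then show ?case
      by (intro exI[of _ "\<lambda>\<gamma>. 0"] exI[of _ "{}"]) (simp add: lp_mass_def)
  next
    case (Suc n)
    then obtain w K where w: "finite K" "K \<subseteq> \<Gamma>" "\<And>\<gamma>. \<gamma> \<notin> K \<Longrightarrow> w \<gamma> = 0"
      "lp_mass p \<Gamma> w \<le> real n * M powr p" "real n * (e / 2) \<le> f w" by blast
    obtain z L where z: "finite L" "L \<subseteq> \<Gamma>" "L \<inter> K = {}" "\<And>\<gamma>. \<gamma> \<notin> L \<Longrightarrow> z \<gamma> = 0"
      "lp_mass p \<Gamma> z \<le> M powr p" "e / 2 \<le> f z" using block[OF w(1,2)] by blast
    have "lp_mass p \<Gamma> (\<lambda>\<gamma>. w \<gamma> + z \<gamma>) = (\<Sum>\<gamma>\<in>K \<union> L. \<bar>w \<gamma> + z \<gamma>\<bar> powr p)"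
      by (rule lp_finite_support(2)) (use w z in auto)
    also have "\<dots> = (\<Sum>\<gamma>\<in>K. \<bar>w \<gamma> + z \<gamma>\<bar> powr p) + (\<Sum>\<gamma>\<in>L. \<bar>w \<gamma> + z \<gamma>\<bar> powr p)"
      using w z by (intro sum.union_disjoint) auto
    also have "(\<Sum>\<gamma>\<in>K. \<bar>w \<gamma> + z \<gamma>\<bar> powr p) = (\<Sum>\<gamma>\<in>K. \<bar>w \<gamma>\<bar> powr p)"
      using z(3,4) by (intro sum.cong refl) (metis IntI add.right_neutral empty_iff)
    also have "(\<Sum>\<gamma>\<in>L. \<bar>w \<gamma> + z \<gamma>\<bar> powr p) = (\<Sum>\<gamma>\<in>L. \<bar>z \<gamma>\<bar> powr p)"
      using z(3) w(3) by (intro sum.cong refl) (metis IntI add.left_neutral empty_iff)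
    also have "(\<Sum>\<gamma>\<in>K. \<bar>w \<gamma>\<bar> powr p) = lp_mass p \<Gamma> w"
      by (rule lp_finite_support(2)[symmetric]) (use w in auto)
    also have "(\<Sum>\<gamma>\<in>L. \<bar>z \<gamma>\<bar> powr p) = lp_mass p \<Gamma> z"
      by (rule lp_finite_support(2)[symmetric]) (use z in auto)
    finally have "lp_mass p \<Gamma> (\<lambda>\<gamma>. w \<gamma> + z \<gamma>) \<le> real (Suc n) * M powr p"
      using w(4) z(5) by (simp add: algebra_simps)
    moreover have "w \<in> lp_space p \<Gamma>" by (rule lp_finite_support(1)[OF w(1-3)])
    then have "f (\<lambda>\<gamma>. w \<gamma> + z \<gamma>) = f w + f z"
      by (rule lp_dual_add[OF f]) (rule lp_finite_support(1)[OF z(1,2,4)])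
    then have "real (Suc n) * (e / 2) \<le> f (\<lambda>\<gamma>. w \<gamma> + z \<gamma>)"
      using w(5) z(6) by (simp add: algebra_simps)
    ultimately show ?case
      using w(1-3) z(1,2,4) by (intro exI[of _ "\<lambda>\<gamma>. w \<gamma> + z \<gamma>"] exI[of _ "K \<union> L"]) auto
  qed
  have bound: "real n * (e / 2) \<le> C * (real n powr (1 / p) * M)" for n
  proof -
    obtain w K where w: "finite K" "K \<subseteq> \<Gamma>" "\<And>\<gamma>. \<gamma> \<notin> K \<Longrightarrow> w \<gamma> = 0"
      "lp_mass p \<Gamma> w \<le> real n * M powr p" "real n * (e / 2) \<le> f w" using chain[of n] by blast
    have "(real n powr (1 / p) * M) powr p = real n * M powr p"
      using p M by (simp add: powr_mult powr_powr)
    then have "lp_norm p \<Gamma> w \<le> real n powr (1 / p) * M"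
      using w(4) M by (subst lp_norm_le_iff[OF p]) auto
    then show ?thesis
      using w(5) C(1) C(2)[OF lp_finite_support(1)[OF w(1-3)]]
      by (meson abs_ge_self mult_left_mono order_trans less_imp_le)
  qed
  define a where "a = 1 - 1 / p"
  have a: "0 < a" using p by (simp add: a_def)
  obtain n :: nat where n: "(C * M / (e / 2)) powr (1 / a) < real n"
    using reals_Archimedean2 by blast
  have "((C * M / (e / 2)) powr (1 / a)) powr a < real n powr a"
    using n a by (intro powr_less_mono2) auto
  then have X: "C * M / (e / 2) < real n powr a"
    using a C(1) M e by (simp add: powr_powr)
  have "0 < real n" using n by (meson le_less_trans powr_ge_zero)
  have "real n powr (1 / p) * real n powr a = real n"
    using \<open>0 < real n\<close> by (simp add: a_def flip: powr_add)
  moreover have "C * M < real n powr a * (e / 2)"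
    using X e by (simp add: field_simps)
  then have "real n powr (1 / p) * (C * M) < real n powr (1 / p) * (real n powr a * (e / 2))"
    using \<open>0 < real n\<close> by (intro mult_strict_left_mono) auto
  ultimately have "C * (real n powr (1 / p) * M) < real n * (e / 2)"
    by (simp add: mult.assoc[symmetric]) (simp add: mult_ac)
  then show False using bound[of n] by linarith
qed

text \<open>The difference of two vectors is split into its part on \<open>F\<close>, whose norm is small because the
  finitely many coordinates are close, and its part off \<open>F\<close>, on which \<open>f\<close> is small.\<close>

lemma lp_dual_coordinatewise_uniformly_continuous:
  assumes p: "1 < p" and f: "f \<in> lp_dual p \<Gamma>" and e: "0 < e" and M: "0 < M"
  obtains F d where "finite F" "F \<subseteq> \<Gamma>" "0 < d"
    "\<And>x y. x \<in> lp_space p \<Gamma> \<Longrightarrow> y \<in> lp_space p \<Gamma> \<Longrightarrow> lp_norm p \<Gamma> x \<le> M \<Longrightarrow> lp_norm p \<Gamma> y \<le> M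
      \<Longrightarrow> (\<And>\<gamma>. \<gamma> \<in> F \<Longrightarrow> \<bar>x \<gamma> - y \<gamma>\<bar> < d) \<Longrightarrow> \<bar>f x - f y\<bar> < e"
proof -
  obtain C where C: "0 < C" "\<And>x. x \<in> lp_space p \<Gamma> \<Longrightarrow> \<bar>f x\<bar> \<le> C * lp_norm p \<Gamma> x"
    using lp_dual_bounded[OF p f] by blast
  obtain F where F: "finite F" "F \<subseteq> \<Gamma>"
    and small: "\<And>z. z \<in> lp_space p \<Gamma> \<Longrightarrow> lp_norm p \<Gamma> z \<le> 2 * M \<Longrightarrow> (\<And>\<gamma>. \<gamma> \<in> F \<Longrightarrow> z \<gamma> = 0)
      \<Longrightarrow> \<bar>f z\<bar> \<le> e / 2"
    using lp_dual_small_off_finite[OF p f, of "e / 2" "2 * M"] e M by auto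
  define r where "r = e / (4 * C)"
  define d where "d = (r powr p / (real (card F) + 1)) powr (1 / p)"
  have r: "0 < r" using e C by (simp add: r_def)
  have d: "0 < d" "d powr p = r powr p / (real (card F) + 1)"
    using r p by (auto simp: d_def powr_powr)
  show thesis
  proof (rule that[OF F d(1)])
    fix x y assume x: "x \<in> lp_space p \<Gamma>" "lp_norm p \<Gamma> x \<le> M" and y: "y \<in> lp_space p \<Gamma>" "lp_norm p \<Gamma> y \<le> M"
      and close: "\<And>\<gamma>. \<gamma> \<in> F \<Longrightarrow> \<bar>x \<gamma> - y \<gamma>\<bar> < d"
    define z where "z = (\<lambda>\<gamma>. x \<gamma> - y \<gamma>)"
    define z1 where "z1 = (\<lambda>\<gamma>. if \<gamma> \<in> F then z \<gamma> else 0)"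
    define z2 where "z2 = (\<lambda>\<gamma>. if \<gamma> \<in> - F then z \<gamma> else 0)"
    have z: "z \<in> lp_space p \<Gamma>" "lp_norm p \<Gamma> z \<le> 2 * M"
      using lp_diff[OF p x(1) y(1)] x(2) y(2) by (auto simp: z_def)
    have z1: "z1 \<in> lp_space p \<Gamma>" unfolding z1_def by (rule lp_restrict[OF p z(1)])
    have z2: "z2 \<in> lp_space p \<Gamma>" "lp_norm p \<Gamma> z2 \<le> lp_norm p \<Gamma> z"
      unfolding z2_def by (rule lp_restrict[OF p z(1)])+
    have "\<bar>f z2\<bar> \<le> e / 2"
      using z2 z(2) by (intro small) (auto simp: z2_def)
    have "lp_mass p \<Gamma> z1 = (\<Sum>\<gamma>\<in>F. \<bar>z1 \<gamma>\<bar> powr p)"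
      by (rule lp_finite_support(2)[OF F]) (simp add: z1_def)
    also have "\<dots> \<le> (\<Sum>\<gamma>\<in>F. d powr p)"
      using close p by (intro sum_mono powr_mono2) (auto simp: z1_def z_def less_imp_le)
    also have "\<dots> \<le> r powr p"
      using r by (simp add: d(2) field_simps)
    finally have "lp_norm p \<Gamma> z1 \<le> r"
      using r by (subst lp_norm_le_iff[OF p]) auto
    then have "\<bar>f z1\<bar> \<le> C * r"
      using C(1) C(2)[OF z1] by (meson mult_left_mono order_trans less_imp_le)
    then have "\<bar>f z1\<bar> < e / 2" using C(1) e by (simp add: r_def)
    have "(\<lambda>\<gamma>. z1 \<gamma> + z2 \<gamma>) = z" by (auto simp: z1_def z2_def)
    then have "f z = f z1 + f z2" using lp_dual_add[OF f z1 z2(1)] by simp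
    then show "\<bar>f x - f y\<bar> < e"
      using lp_dual_diff[OF p f x(1) y(1)] \<open>\<bar>f z1\<bar> < e / 2\<close> \<open>\<bar>f z2\<bar> \<le> e / 2\<close> by (simp add: z_def)
  qed
qed

abbreviation weak_lp :: "real \<Rightarrow> 'a set \<Rightarrow> ('a \<Rightarrow> real) topology" where
  "weak_lp p \<Gamma> \<equiv> weak_topology (lp_space p \<Gamma>) (lp_norm p \<Gamma>)"

lemma weak_open_contains_coordinate_box:
  assumes p: "1 < p" and M: "0 < M" and W: "openin (weak_lp p \<Gamma>) W"
    and x: "x \<in> W" "x \<in> lp_space p \<Gamma>" "lp_norm p \<Gamma> x \<le> M"
  obtains F d where "finite F" "F \<subseteq> \<Gamma>" "0 < d"
    "\<And>y. y \<in> lp_space p \<Gamma> \<Longrightarrow> lp_norm p \<Gamma> y \<le> M \<Longrightarrow> (\<And>\<gamma>. \<gamma> \<in> F \<Longrightarrow> \<bar>y \<gamma> - x \<gamma>\<bar> < d) \<Longrightarrow> y \<in> W"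
proof -
  define box where "box F d W \<longleftrightarrow> finite F \<and> F \<subseteq> \<Gamma> \<and> 0 < d \<and>
    (\<forall>y\<in>lp_space p \<Gamma>. lp_norm p \<Gamma> y \<le> M \<longrightarrow> (\<forall>\<gamma>\<in>F. \<bar>y \<gamma> - x \<gamma>\<bar> < d) \<longrightarrow> y \<in> W)" for F d W
  have "generate_topology_on {{x \<in> lp_space p \<Gamma>. f x \<in> U} | f U. f \<in> lp_dual p \<Gamma> \<and> open U} W"
    using W unfolding weak_topology_def openin_topology_generated_by_iff .
  then have "x \<in> W \<longrightarrow> (\<exists>F d. box F d W)"
  proof induction
    case Empty
    then show ?case by simp
  next
    case (Int a b)
    have "box (F \<union> G) (min d e) (a \<inter> b)" if "box F d a" "box G e b" for F G d e
      using that unfolding box_def by auto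
    then show ?case using Int.IH by blast
  next
    case (UN K)
    have "box F d (\<Union>K)" if "box F d k" "k \<in> K" for F d k
      using that unfolding box_def by blast
    then show ?case using UN.IH by blast
  next
    case (Basis s)
    then obtain f U where s: "s = {x \<in> lp_space p \<Gamma>. f x \<in> U}" and f: "f \<in> lp_dual p \<Gamma>" and U: "open U"
      by blast
    show ?case
    proof
      assume "x \<in> s"
      then obtain e where e: "0 < e" "ball (f x) e \<subseteq> U"
        using U s openE by blast
      obtain F d where Fd: "finite F" "F \<subseteq> \<Gamma>" "0 < d"
        and uc: "\<And>x y. x \<in> lp_space p \<Gamma> \<Longrightarrow> y \<in> lp_space p \<Gamma> \<Longrightarrow> lp_norm p \<Gamma> x \<le> M \<Longrightarrow> lp_norm p \<Gamma> y \<le> M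
          \<Longrightarrow> (\<And>\<gamma>. \<gamma> \<in> F \<Longrightarrow> \<bar>x \<gamma> - y \<gamma>\<bar> < d) \<Longrightarrow> \<bar>f x - f y\<bar> < e"
        using lp_dual_coordinatewise_uniformly_continuous[OF p f e(1) M] by metis
      have "y \<in> s" if y: "y \<in> lp_space p \<Gamma>" "lp_norm p \<Gamma> y \<le> M" "\<forall>\<gamma>\<in>F. \<bar>y \<gamma> - x \<gamma>\<bar> < d" for y
      proof -
        have "\<bar>f y - f x\<bar> < e" using y x(2,3) by (intro uc) auto
        then have "f y \<in> ball (f x) e" by (simp add: dist_real_def abs_minus_commute)
        then show ?thesis using e(2) y(1) s by blast
      qed
      then have "box F d s" using Fd by (simp add: box_def)
      then show "\<exists>F d. box F d s" by blast
    qed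
  qed
  then obtain F d where "box F d W" using x(1) by blast
  then show thesis using that[of F d] unfolding box_def by blast
qed

lemma coordinate_in_lp_dual:
  assumes p: "1 < p"
  shows "(\<lambda>x. x \<gamma>) \<in> lp_dual p \<Gamma>"
proof -
  note en = everywhere_even_norm_lp_norm[OF p, of \<Gamma>]
  have "openin (norm_topology (lp_space p \<Gamma>) (lp_norm p \<Gamma>)) {x \<in> lp_space p \<Gamma>. x \<gamma> \<in> U}"
    if U: "open U" for U
    unfolding openin_norm_topology_lp[OF p en]
  proof (intro conjI ballI)
    fix x assume "x \<in> {x \<in> lp_space p \<Gamma>. x \<gamma> \<in> U}"
    then have x: "x \<in> lp_space p \<Gamma>" "x \<gamma> \<in> U" by auto
    obtain r where r: "0 < r" "ball (x \<gamma>) r \<subseteq> U" using U x(2) openE by blast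
    have "y \<in> {x \<in> lp_space p \<Gamma>. x \<gamma> \<in> U}"
      if y: "y \<in> lp_space p \<Gamma>" "lp_norm p \<Gamma> (\<lambda>\<gamma>. x \<gamma> - y \<gamma>) < r" for y
    proof -
      have "\<bar>x \<gamma> - y \<gamma>\<bar> < r"
        using abs_le_lp_norm[OF p lp_diff(1)[OF p x(1) y(1)], of \<gamma>] y(2) by simp
      then have "y \<gamma> \<in> ball (x \<gamma>) r" by (simp add: dist_real_def)
      then show ?thesis using r(2) y(1) by blast
    qed
    then show "\<exists>r>0. \<forall>y\<in>lp_space p \<Gamma>. lp_norm p \<Gamma> (\<lambda>\<gamma>. x \<gamma> - y \<gamma>) < r \<longrightarrow> y \<in> {x \<in> lp_space p \<Gamma>. x \<gamma> \<in> U}"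
      using r(1) by blast
  qed auto
  then have "continuous_map (norm_topology (lp_space p \<Gamma>) (lp_norm p \<Gamma>)) euclideanreal (\<lambda>x. x \<gamma>)"
    unfolding continuous_map_def topspace_norm_topology_lp[OF p en] by (simp flip: open_openin)
  then show ?thesis by (simp add: continuous_dual_def)
qed

lemma openin_weak_lp_coordinate:
  assumes "1 < p" "open U"
  shows "openin (weak_lp p \<Gamma>) {x \<in> lp_space p \<Gamma>. x \<gamma> \<in> U}"
  unfolding weak_topology_def openin_topology_generated_by_iff
proof (intro generate_topology_on.Basis CollectI exI conjI)
  show "{x \<in> lp_space p \<Gamma>. x \<gamma> \<in> U} = {x \<in> lp_space p \<Gamma>. (\<lambda>x. x \<gamma>) x \<in> U}" by simp
qed (use assms coordinate_in_lp_dual in auto)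

lemma topspace_weak_lp:
  assumes "1 < p"
  shows "topspace (weak_lp p \<Gamma>) = lp_space p \<Gamma>"
proof
  show "topspace (weak_lp p \<Gamma>) \<subseteq> lp_space p \<Gamma>"
    unfolding weak_topology_def topology_generated_by_topspace by blast
  show "lp_space p \<Gamma> \<subseteq> topspace (weak_lp p \<Gamma>)"
    using openin_subset[OF openin_weak_lp_coordinate[OF assms open_UNIV]] by simp
qed

lemma openin_weak_lp_box:
  assumes p: "1 < p" and F: "finite F"
  shows "openin (weak_lp p \<Gamma>) {y \<in> lp_space p \<Gamma>. \<forall>\<gamma>\<in>F. \<bar>y \<gamma> - x \<gamma>\<bar> < h}"
  using F
proof induction
  case empty
  show ?case using openin_topspace[of "weak_lp p \<Gamma>"] by (simp add: topspace_weak_lp[OF p])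
next
  case (insert a F)
  have op: "openin (weak_lp p \<Gamma>) {y \<in> lp_space p \<Gamma>. y a \<in> {x a - h <..< x a + h}}"
    by (rule openin_weak_lp_coordinate[OF p open_greaterThanLessThan])
  have eq: "{y \<in> lp_space p \<Gamma>. \<forall>\<gamma>\<in>insert a F. \<bar>y \<gamma> - x \<gamma>\<bar> < h}
    = {y \<in> lp_space p \<Gamma>. y a \<in> {x a - h <..< x a + h}} \<inter> {y \<in> lp_space p \<Gamma>. \<forall>\<gamma>\<in>F. \<bar>y \<gamma> - x \<gamma>\<bar> < h}"
    by (auto simp: abs_less_iff)
  show ?case unfolding eq by (rule openin_Int[OF op insert.IH])
qed

section \<open>The dichotomy for open sets\<close>

text \<open>The second alternative lets the neighbourhoods shrink. This gives room for the approximations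
  made in the usual ball, and it does not help in the ball of a graph norm, where any two smaller neighbourhoods
  of unit vectors still meet for non-adjacent indices outside each other's finite set of coordinates.\<close>

definition open_dichotomy :: "'i set \<Rightarrow> 'b topology \<Rightarrow> bool" where
  "open_dichotomy J X \<longleftrightarrow> (\<forall>x V. (\<forall>i\<in>J. openin X (V i) \<and> x i \<in> V i) \<longrightarrow>
     (\<exists>A\<subseteq>J. uncountable A \<and>
       ((\<forall>i\<in>A. \<forall>j\<in>A. i \<noteq> j \<longrightarrow> V i \<inter> V j \<noteq> {}) \<or>
        (\<exists>U. (\<forall>i\<in>A. openin X (U i) \<and> x i \<in> U i) \<and> (\<forall>i\<in>A. \<forall>j\<in>A. i \<noteq> j \<longrightarrow> U i \<inter> U j = {})))))"

lemma open_dichotomyE: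
  assumes "open_dichotomy J X" "\<forall>i\<in>J. openin X (V i) \<and> x i \<in> V i"
  obtains A where "A \<subseteq> J" "uncountable A"
    "(\<forall>i\<in>A. \<forall>j\<in>A. i \<noteq> j \<longrightarrow> V i \<inter> V j \<noteq> {}) \<or>
     (\<exists>U. (\<forall>i\<in>A. openin X (U i) \<and> x i \<in> U i) \<and> (\<forall>i\<in>A. \<forall>j\<in>A. i \<noteq> j \<longrightarrow> U i \<inter> U j = {}))"
  using mp[OF spec[OF spec[OF assms(1)[unfolded open_dichotomy_def], of x], of V] assms(2)]
  by (elim exE conjE) (rule that)

lemma open_dichotomy_homeomorphic:
  assumes hom: "X homeomorphic_space Y" and X: "open_dichotomy J X"
  shows "open_dichotomy J Y"
  unfolding open_dichotomy_def
proof (intro allI impI)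
  fix y V assume V: "\<forall>i\<in>J. openin Y (V i) \<and> y i \<in> V i"
  obtain f g where fg: "homeomorphic_maps X Y f g"
    using hom by (auto simp: homeomorphic_space_def)
  then have f: "continuous_map X Y f" and g: "continuous_map Y X g"
    and gf: "\<And>x. x \<in> topspace X \<Longrightarrow> g (f x) = x" and fg: "\<And>y. y \<in> topspace Y \<Longrightarrow> f (g y) = y"
    by (auto simp: homeomorphic_maps_def)
  have gX: "g z \<in> topspace X" if "z \<in> topspace Y" for z
    using continuous_map_image_subset_topspace[OF g] that by blast
  have fY: "f z \<in> topspace Y" if "z \<in> topspace X" for z
    using continuous_map_image_subset_topspace[OF f] that by blast
  define V' where "V' i = {z \<in> topspace X. f z \<in> V i}" for i
  have yY: "y i \<in> topspace Y" if "i \<in> J" for i using V that openin_subset by blast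
  have V': "\<forall>i\<in>J. openin X (V' i) \<and> g (y i) \<in> V' i"
  proof (intro ballI conjI)
    fix i assume i: "i \<in> J"
    show "openin X (V' i)"
      unfolding V'_def using V i by (intro openin_continuous_map_preimage[OF f]) blast
    show "g (y i) \<in> V' i"
      using V i yY gX fg by (simp add: V'_def)
  qed
  obtain A where A: "A \<subseteq> J" "uncountable A" and dich:
    "(\<forall>i\<in>A. \<forall>j\<in>A. i \<noteq> j \<longrightarrow> V' i \<inter> V' j \<noteq> {}) \<or>
     (\<exists>U. (\<forall>i\<in>A. openin X (U i) \<and> g (y i) \<in> U i) \<and> (\<forall>i\<in>A. \<forall>j\<in>A. i \<noteq> j \<longrightarrow> U i \<inter> U j = {}))"
    using open_dichotomyE[OF X V'] by metis
  from dich have "(\<forall>i\<in>A. \<forall>j\<in>A. i \<noteq> j \<longrightarrow> V i \<inter> V j \<noteq> {}) \<or>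
     (\<exists>U. (\<forall>i\<in>A. openin Y (U i) \<and> y i \<in> U i) \<and> (\<forall>i\<in>A. \<forall>j\<in>A. i \<noteq> j \<longrightarrow> U i \<inter> U j = {}))"
  proof (elim disjE exE conjE)
    assume meet: "\<forall>i\<in>A. \<forall>j\<in>A. i \<noteq> j \<longrightarrow> V' i \<inter> V' j \<noteq> {}"
    have "V i \<inter> V j \<noteq> {}" if "i \<in> A" "j \<in> A" "i \<noteq> j" for i j
    proof -
      obtain z where "z \<in> V' i" "z \<in> V' j" using meet \<open>i \<in> A\<close> \<open>j \<in> A\<close> \<open>i \<noteq> j\<close> by blast
      then show ?thesis by (auto simp: V'_def)
    qed
    then show ?thesis by blast
  next
    fix U assume U: "\<forall>i\<in>A. openin X (U i) \<and> g (y i) \<in> U i"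
      and disj: "\<forall>i\<in>A. \<forall>j\<in>A. i \<noteq> j \<longrightarrow> U i \<inter> U j = {}"
    define U' where "U' i = {z \<in> topspace Y. g z \<in> U i}" for i
    have "openin Y (U' i) \<and> y i \<in> U' i" if i: "i \<in> A" for i
    proof
      show "openin Y (U' i)"
        unfolding U'_def using U i by (intro openin_continuous_map_preimage[OF g]) blast
      show "y i \<in> U' i" using U i A(1) yY by (auto simp: U'_def)
    qed
    moreover have "U' i \<inter> U' j = {}" if "i \<in> A" "j \<in> A" "i \<noteq> j" for i j
      using disj that by (auto simp: U'_def disjoint_iff)
    ultimately show ?thesis by (intro disjI2 exI[of _ U']) blast
  qed
  then show "\<exists>A\<subseteq>J. uncountable A \<and> ((\<forall>i\<in>A. \<forall>j\<in>A. i \<noteq> j \<longrightarrow> V i \<inter> V j \<noteq> {}) \<or>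
     (\<exists>U. (\<forall>i\<in>A. openin Y (U i) \<and> y i \<in> U i) \<and> (\<forall>i\<in>A. \<forall>j\<in>A. i \<noteq> j \<longrightarrow> U i \<inter> U j = {})))"
    using A by (intro exI[of _ A] conjI)
qed


section \<open>The usual ball\<close>

abbreviation weak_ball :: "real \<Rightarrow> 'a set \<Rightarrow> (('a \<Rightarrow> real) \<Rightarrow> real) \<Rightarrow> ('a \<Rightarrow> real) topology" where
  "weak_ball p \<Gamma> N \<equiv> subtopology (weak_lp p \<Gamma>) (closed_unit_ball (lp_space p \<Gamma>) N)"

lemma weak_ball_nbhd_contains_box:
  assumes p: "1 < p" and M: "0 < M" and N: "\<And>y. y \<in> lp_space p \<Gamma> \<Longrightarrow> N y \<le> 1 \<Longrightarrow> lp_norm p \<Gamma> y \<le> M"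
    and V: "openin (weak_ball p \<Gamma> N) V" "x \<in> V"
  shows "\<exists>F d. finite F \<and> F \<subseteq> \<Gamma> \<and> 0 < d \<and>
    (\<forall>y\<in>lp_space p \<Gamma>. N y \<le> 1 \<longrightarrow> (\<forall>\<gamma>\<in>F. \<bar>y \<gamma> - x \<gamma>\<bar> < d) \<longrightarrow> y \<in> V)"
proof -
  obtain W where W: "openin (weak_lp p \<Gamma>) W" "V = W \<inter> closed_unit_ball (lp_space p \<Gamma>) N"
    using V(1) by (auto simp: openin_subtopology)
  have x: "x \<in> W" "x \<in> lp_space p \<Gamma>" "lp_norm p \<Gamma> x \<le> M"
    using V(2) W(2) N by (auto simp: closed_unit_ball_def)
  obtain F d where Fd: "finite F" "F \<subseteq> \<Gamma>" "0 < d"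
    and box: "\<And>y. y \<in> lp_space p \<Gamma> \<Longrightarrow> lp_norm p \<Gamma> y \<le> M \<Longrightarrow> (\<And>\<gamma>. \<gamma> \<in> F \<Longrightarrow> \<bar>y \<gamma> - x \<gamma>\<bar> < d) \<Longrightarrow> y \<in> W"
    using weak_open_contains_coordinate_box[OF p M W(1) x] by metis
  have "\<forall>y\<in>lp_space p \<Gamma>. N y \<le> 1 \<longrightarrow> (\<forall>\<gamma>\<in>F. \<bar>y \<gamma> - x \<gamma>\<bar> < d) \<longrightarrow> y \<in> V"
    using box N W(2) by (simp add: closed_unit_ball_def)
  then show ?thesis using Fd by blast
qed

text \<open>Half of the common box size, \<open>h\<close>, is used both to move each \<open>x i\<close> towards \<open>0\<close> on \<open>F i\<close> and as
  the size of the shrunken neighbourhoods. The quantities \<open>r i\<close> and \<open>s i\<close> are the masses, on the root and off it,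
  of \<open>x i\<close> after this move; they are lower bounds for the masses there of any vector in the small box. If
  \<open>r i / 2 + s i \<le> 1 / 2\<close> for two indices, gluing their moved vectors, with the root values of the
  index having the smaller \<open>r\<close>, gives a point of the ball in both neighbourhoods. If \<open>r i / 2 + s i > 1 / 2\<close> for
  two indices, a common point of the small boxes would have mass at least
  \<open>max (r i) (r j) + s i + s j > 1\<close>.\<close>

lemma lp_ball_open_dichotomy:
  fixes \<Gamma> :: "'a set" and J :: "'i set"
  assumes p: "1 < p" and J: "uncountable J"
  shows "open_dichotomy J (weak_ball p \<Gamma> (lp_norm p \<Gamma>))"
  unfolding open_dichotomy_def
proof (intro allI impI)
  let ?B = "weak_ball p \<Gamma> (lp_norm p \<Gamma>)"
  fix x V assume V: "\<forall>i\<in>J. openin ?B (V i) \<and> x i \<in> V i"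
  have xB: "x i \<in> lp_space p \<Gamma> \<and> lp_norm p \<Gamma> (x i) \<le> 1" if "i \<in> J" for i
    using V that openin_subset[of ?B "V i"] by (auto simp: closed_unit_ball_def)
  have "\<forall>i\<in>J. \<exists>F d. finite F \<and> F \<subseteq> \<Gamma> \<and> 0 < d \<and>
    (\<forall>y\<in>lp_space p \<Gamma>. lp_norm p \<Gamma> y \<le> 1 \<longrightarrow> (\<forall>\<gamma>\<in>F. \<bar>y \<gamma> - x i \<gamma>\<bar> < d) \<longrightarrow> y \<in> V i)"
    using V by (intro ballI weak_ball_nbhd_contains_box[OF p zero_less_one]) auto
  then obtain F e where F: "\<And>i. i \<in> J \<Longrightarrow> finite (F i)" "\<And>i. i \<in> J \<Longrightarrow> F i \<subseteq> \<Gamma>"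
    and e: "\<And>i. i \<in> J \<Longrightarrow> 0 < e i"
    and box: "\<And>i y. i \<in> J \<Longrightarrow> y \<in> lp_space p \<Gamma> \<Longrightarrow> lp_norm p \<Gamma> y \<le> 1
      \<Longrightarrow> (\<And>\<gamma>. \<gamma> \<in> F i \<Longrightarrow> \<bar>y \<gamma> - x i \<gamma>\<bar> < e i) \<Longrightarrow> y \<in> V i"
    by metis
  have "\<forall>i\<in>J. \<exists>n. 1 / real (Suc n) < e i" using e nat_approx_posE by metis
  then obtain k where k: "\<And>i. i \<in> J \<Longrightarrow> 1 / real (Suc (k i)) < e i" by metis
  obtain n where n: "uncountable {i \<in> J. k i = n}"
    using uncountable_fibre[OF J, of k] by blast
  define h where "h = 1 / real (Suc n) / 2"
  have h: "0 < h" by (simp add: h_def)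
  obtain A1 R where A1: "A1 \<subseteq> {i \<in> J. k i = n}" "uncountable A1"
    and RF: "\<And>i. i \<in> A1 \<Longrightarrow> R \<subseteq> F i"
    and root: "\<And>i j. i \<in> A1 \<Longrightarrow> j \<in> A1 \<Longrightarrow> i \<noteq> j \<Longrightarrow> F i \<inter> F j = R"
    using delta_system[OF n, of F] F(1) by blast
  have A1J: "i \<in> J" "2 * h < e i" if "i \<in> A1" for i
  proof -
    show i: "i \<in> J" using that A1(1) by blast
    have "k i = n" using that A1(1) by blast
    moreover have "2 * h = 1 / real (Suc n)" unfolding h_def by (simp only: field_sum_of_halves mult_2)
    ultimately show "2 * h < e i" using k[OF i] by simp
  qed
  have "A1 \<noteq> {}" using A1(2) by auto
  then have R: "finite R" using RF F(1) A1J(1) by (meson ex_in_conv finite_subset)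
  \<comment> \<open>equal grid cells on the root: the root values of two indices differ by less than \<open>h\<close>\<close>
  define grid where "grid i = (\<lambda>\<gamma>\<in>R. \<lfloor>x i \<gamma> / h\<rfloor>)" for i
  have "countable (PiE R (\<lambda>_. UNIV :: int set))"
    using R by (intro countable_PiE) auto
  moreover have "grid ` A1 \<subseteq> PiE R (\<lambda>_. UNIV :: int set)" by (auto simp: grid_def)
  ultimately have "countable (grid ` A1)" by (rule countable_subset[rotated])
  then obtain c where c: "uncountable {i \<in> A1. grid i = c}"
    using uncountable_fibre[OF A1(2)] by blast
  define q where "q i \<gamma> = max (\<bar>x i \<gamma>\<bar> - h) 0 powr p" for i \<gamma>
  define r where "r i = (\<Sum>\<gamma>\<in>R. q i \<gamma>)" for i
  define s where "s i = (\<Sum>\<gamma>\<in>F i - R. q i \<gamma>)" for i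
  \<comment> \<open>one of the two sides of the threshold contains uncountably many indices\<close>
  obtain b where b: "uncountable {i \<in> {i \<in> A1. grid i = c}. (r i / 2 + s i \<le> 1 / 2) = b}"
    using uncountable_fibre[OF c, of "\<lambda>i. r i / 2 + s i \<le> 1 / 2"] by blast
  define A where "A = {i \<in> {i \<in> A1. grid i = c}. (r i / 2 + s i \<le> 1 / 2) = b}"
  have A: "uncountable A" "A \<subseteq> J" using b A1(1) by (auto simp: A_def)
  have AA1: "i \<in> A1" and Ab: "(r i / 2 + s i \<le> 1 / 2) = b" if "i \<in> A" for i
    using that by (auto simp: A_def)
  have near: "\<bar>x i \<gamma> - x j \<gamma>\<bar> < h" if "i \<in> A" "j \<in> A" "\<gamma> \<in> R" for i j \<gamma>
  proof -
    have "grid i \<gamma> = grid j \<gamma>" using that by (simp add: A_def)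
    then have "\<lfloor>x i \<gamma> / h\<rfloor> = \<lfloor>x j \<gamma> / h\<rfloor>" using that(3) by (simp add: grid_def)
    then have "\<bar>x i \<gamma> / h - x j \<gamma> / h\<bar> < 1" by linarith
    then show ?thesis using h by (simp add: field_simps flip: diff_divide_distrib)
  qed
  have split: "(\<Sum>\<gamma>\<in>F i \<union> F j. g \<gamma>) = (\<Sum>\<gamma>\<in>R. g \<gamma>) + (\<Sum>\<gamma>\<in>F i - R. g \<gamma>) + (\<Sum>\<gamma>\<in>F j - R. g \<gamma>)"
    if ij: "i \<in> A" "j \<in> A" "i \<noteq> j" for i j and g :: "'a \<Rightarrow> real"
  proof -
    have fin: "finite (F i)" "finite (F j)" using ij AA1 A1J(1) F(1) by auto
    have int: "F i \<inter> F j = R" using ij AA1 root by auto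
    then have eq: "F i \<union> F j = R \<union> (F i - R) \<union> (F j - R)" by blast
    show ?thesis
      unfolding eq using fin R int by (subst sum.union_disjoint; (subst sum.union_disjoint)?) auto
  qed
  have meet: "V i \<inter> V j \<noteq> {}" if ij: "i \<in> A" "j \<in> A" "i \<noteq> j" "r i \<le> r j" and b for i j
  proof -
    \<comment> \<open>the moved vectors glued together, with the values of \<open>x i\<close> on the root\<close>
    define w where "w \<gamma> = (if \<gamma> \<in> F i then sgn (x i \<gamma>) * max (\<bar>x i \<gamma>\<bar> - h) 0
      else if \<gamma> \<in> F j then sgn (x j \<gamma>) * max (\<bar>x j \<gamma>\<bar> - h) 0 else 0)" for \<gamma>
    have int: "F i \<inter> F j = R" using ij AA1 root by auto
    have iJ: "i \<in> J" "j \<in> J" using ij AA1 A1J(1) by auto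
    have abs: "\<bar>sgn t * max (\<bar>t\<bar> - h) 0\<bar> = max (\<bar>t\<bar> - h) 0" for t :: real
      using h by (auto simp: abs_mult sgn_if)
    have dist: "\<bar>sgn t * max (\<bar>t\<bar> - h) 0 - t\<bar> \<le> h" for t :: real
      using h by (auto simp: sgn_if max_def)
    have fs: "finite (F i \<union> F j)" "F i \<union> F j \<subseteq> \<Gamma>" "\<And>\<gamma>. \<gamma> \<notin> F i \<union> F j \<Longrightarrow> w \<gamma> = 0"
      using iJ F by (auto simp: w_def)
    have "lp_mass p \<Gamma> w = (\<Sum>\<gamma>\<in>F i \<union> F j. \<bar>w \<gamma>\<bar> powr p)"
      by (rule lp_finite_support(2)[OF fs])
    also have "\<dots> = (\<Sum>\<gamma>\<in>R. \<bar>w \<gamma>\<bar> powr p) + (\<Sum>\<gamma>\<in>F i - R. \<bar>w \<gamma>\<bar> powr p) + (\<Sum>\<gamma>\<in>F j - R. \<bar>w \<gamma>\<bar> powr p)"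
      by (rule split[OF ij(1-3)])
    also have "(\<Sum>\<gamma>\<in>R. \<bar>w \<gamma>\<bar> powr p) = r i"
      unfolding r_def q_def using int by (intro sum.cong refl) (auto simp: w_def abs)
    also have "(\<Sum>\<gamma>\<in>F i - R. \<bar>w \<gamma>\<bar> powr p) = s i"
      unfolding s_def q_def by (intro sum.cong refl) (auto simp: w_def abs)
    also have "(\<Sum>\<gamma>\<in>F j - R. \<bar>w \<gamma>\<bar> powr p) = s j"
      unfolding s_def q_def using int by (intro sum.cong refl) (auto simp: w_def abs)
    also have "r i + s i + s j \<le> 1"
      using Ab[OF ij(1)] Ab[OF ij(2)] \<open>b\<close> ij(4) by simp
    finally have w: "lp_norm p \<Gamma> w \<le> 1"
      by (simp add: lp_norm_le_iff[OF p])
    have wV: "w \<in> lp_space p \<Gamma>" by (rule lp_finite_support(1)[OF fs])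
    have "w \<in> V i"
    proof (rule box[OF iJ(1) wV w])
      fix \<gamma> assume "\<gamma> \<in> F i"
      then have "\<bar>w \<gamma> - x i \<gamma>\<bar> \<le> h" using dist by (simp add: w_def)
      then show "\<bar>w \<gamma> - x i \<gamma>\<bar> < e i" using A1J(2)[OF AA1[OF ij(1)]] h by linarith
    qed
    moreover have "w \<in> V j"
    proof (rule box[OF iJ(2) wV w])
      fix \<gamma> assume \<gamma>: "\<gamma> \<in> F j"
      have "\<bar>w \<gamma> - x j \<gamma>\<bar> < 2 * h"
      proof (cases "\<gamma> \<in> F i")
        case True
        then have "\<bar>w \<gamma> - x i \<gamma>\<bar> \<le> h" using dist by (simp add: w_def)
        moreover have "\<bar>x i \<gamma> - x j \<gamma>\<bar> < h" using near[OF ij(1,2)] True \<gamma> int by blast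
        ultimately show ?thesis by linarith
      next
        case False
        then have "\<bar>w \<gamma> - x j \<gamma>\<bar> \<le> h" using dist \<gamma> by (simp add: w_def)
        then show ?thesis using h by linarith
      qed
      then show "\<bar>w \<gamma> - x j \<gamma>\<bar> < e j" using A1J(2)[OF AA1[OF ij(2)]] by linarith
    qed
    ultimately show ?thesis by blast
  qed
  have "(\<forall>i\<in>A. \<forall>j\<in>A. i \<noteq> j \<longrightarrow> V i \<inter> V j \<noteq> {}) \<or>
     (\<exists>U. (\<forall>i\<in>A. openin ?B (U i) \<and> x i \<in> U i) \<and> (\<forall>i\<in>A. \<forall>j\<in>A. i \<noteq> j \<longrightarrow> U i \<inter> U j = {}))"
  proof (cases b)
    case True
    have "V i \<inter> V j \<noteq> {}" if "i \<in> A" "j \<in> A" "i \<noteq> j" for i j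
      using meet[OF that _ True] meet[of j i] that True by (metis Int_commute linear)
    then show ?thesis by blast
  next
    case False
    define U where "U i = {y \<in> lp_space p \<Gamma>. \<forall>\<gamma>\<in>F i. \<bar>y \<gamma> - x i \<gamma>\<bar> < h}
      \<inter> closed_unit_ball (lp_space p \<Gamma>) (lp_norm p \<Gamma>)" for i
    have "openin ?B (U i) \<and> x i \<in> U i" if i: "i \<in> A" for i
    proof
      have iJ: "i \<in> J" using i AA1 A1J(1) by blast
      show "openin ?B (U i)"
        unfolding U_def by (intro openin_subtopology_Int openin_weak_lp_box p F(1) iJ)
      show "x i \<in> U i" using xB[OF iJ] h by (simp add: U_def closed_unit_ball_def)
    qed
    moreover have "U i \<inter> U j = {}" if ij: "i \<in> A" "j \<in> A" "i \<noteq> j" for i j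
    proof (rule ccontr)
      assume "U i \<inter> U j \<noteq> {}"
      then obtain y where y: "y \<in> lp_space p \<Gamma>" "lp_norm p \<Gamma> y \<le> 1"
        "\<And>\<gamma>. \<gamma> \<in> F i \<Longrightarrow> \<bar>y \<gamma> - x i \<gamma>\<bar> < h" "\<And>\<gamma>. \<gamma> \<in> F j \<Longrightarrow> \<bar>y \<gamma> - x j \<gamma>\<bar> < h"
        by (auto simp: U_def closed_unit_ball_def)
      have iJ: "i \<in> J" "j \<in> J" using ij AA1 A1J(1) by auto
      have q: "q l \<gamma> \<le> \<bar>y \<gamma>\<bar> powr p" if "\<bar>y \<gamma> - x l \<gamma>\<bar> < h" for l \<gamma>
        unfolding q_def using that p by (intro powr_mono2) auto
      have qi: "q i \<gamma> \<le> \<bar>y \<gamma>\<bar> powr p" if "\<gamma> \<in> F i" for \<gamma> using q y(3) that by blast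
      have qj: "q j \<gamma> \<le> \<bar>y \<gamma>\<bar> powr p" if "\<gamma> \<in> F j" for \<gamma> using q y(4) that by blast
      have "r i \<le> (\<Sum>\<gamma>\<in>R. \<bar>y \<gamma>\<bar> powr p)" "r j \<le> (\<Sum>\<gamma>\<in>R. \<bar>y \<gamma>\<bar> powr p)"
        unfolding r_def using RF[OF AA1[OF ij(1)]] RF[OF AA1[OF ij(2)]]
        by (auto intro!: sum_mono qi qj)
      moreover have "s i \<le> (\<Sum>\<gamma>\<in>F i - R. \<bar>y \<gamma>\<bar> powr p)" "s j \<le> (\<Sum>\<gamma>\<in>F j - R. \<bar>y \<gamma>\<bar> powr p)"
        unfolding s_def by (auto intro!: sum_mono qi qj)
      moreover have "(\<Sum>\<gamma>\<in>F i \<union> F j. \<bar>y \<gamma>\<bar> powr p) \<le> lp_mass p \<Gamma> y"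
        using F iJ by (intro finite_sum_le_lp_mass[OF y(1)]) auto
      moreover have "lp_mass p \<Gamma> y \<le> 1"
        using y(2) by (simp add: lp_norm_le_iff[OF p])
      moreover have "1 / 2 < r i / 2 + s i" "1 / 2 < r j / 2 + s j"
        using Ab[OF ij(1)] Ab[OF ij(2)] False by auto
      ultimately show False unfolding split[OF ij] by linarith
    qed
    ultimately show ?thesis by (intro disjI2 exI[of _ U]) blast
  qed
  then show "\<exists>A\<subseteq>J. uncountable A \<and> ((\<forall>i\<in>A. \<forall>j\<in>A. i \<noteq> j \<longrightarrow> V i \<inter> V j \<noteq> {}) \<or>
     (\<exists>U. (\<forall>i\<in>A. openin ?B (U i) \<and> x i \<in> U i) \<and> (\<forall>i\<in>A. \<forall>j\<in>A. i \<noteq> j \<longrightarrow> U i \<inter> U j = {})))"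
    using A by (intro exI[of _ A] conjI)
qed


section \<open>A ball governed by a graph\<close>

text \<open>The inserted \<open>0\<close> keeps the supremum meaningful for a graph without edges. The factor \<open>1 / 2\<close>
  makes room for the sum of two unit vectors, whose usual norm is at most \<open>2\<close>, in the unit ball. The
  maximum with a multiple of the usual norm makes the function nonnegative even where the supremum
  is taken over an unbounded set.\<close>

definition graph_norm :: "('a \<Rightarrow> 'a \<Rightarrow> bool) \<Rightarrow> real \<Rightarrow> 'a set \<Rightarrow> ('a \<Rightarrow> real) \<Rightarrow> real" where
  "graph_norm E p \<Gamma> x = max (lp_norm p \<Gamma> x / 2) (Sup (insert 0 {\<bar>x a\<bar> + \<bar>x b\<bar> | a b. E a b}))"

lemma graph_norm_le_iff:
  assumes p: "1 < p" and x: "x \<in> lp_space p \<Gamma>" and c: "0 \<le> c"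
  shows "graph_norm E p \<Gamma> x \<le> c \<longleftrightarrow> lp_norm p \<Gamma> x \<le> 2 * c \<and> (\<forall>a b. E a b \<longrightarrow> \<bar>x a\<bar> + \<bar>x b\<bar> \<le> c)"
proof -
  let ?S = "insert 0 {\<bar>x a\<bar> + \<bar>x b\<bar> | a b. E a b}"
  have "\<bar>x a\<bar> + \<bar>x b\<bar> \<le> 2 * lp_norm p \<Gamma> x" for a b
    using abs_le_lp_norm[OF p x, of a] abs_le_lp_norm[OF p x, of b] by linarith
  then have "bdd_above ?S"
    using lp_norm_nonneg[of p \<Gamma> x] by (intro bdd_aboveI[of _ "2 * lp_norm p \<Gamma> x"]) auto
  then have "Sup ?S \<le> c \<longleftrightarrow> (\<forall>a b. E a b \<longrightarrow> \<bar>x a\<bar> + \<bar>x b\<bar> \<le> c)"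
    using c by (subst cSup_le_iff) auto
  then show ?thesis by (auto simp: graph_norm_def)
qed

lemma graph_norm_nonneg: "0 \<le> graph_norm E p \<Gamma> x"
  using lp_norm_nonneg[of p \<Gamma> x] by (simp add: graph_norm_def le_max_iff_disj)

lemma lp_norm_le_graph_norm: "lp_norm p \<Gamma> x \<le> 2 * graph_norm E p \<Gamma> x"
  by (simp add: graph_norm_def max_def)

lemma graph_norm_le_lp_norm:
  assumes p: "1 < p" and x: "x \<in> lp_space p \<Gamma>"
  shows "graph_norm E p \<Gamma> x \<le> 2 * lp_norm p \<Gamma> x"
proof -
  have "\<bar>x a\<bar> + \<bar>x b\<bar> \<le> 2 * lp_norm p \<Gamma> x" for a b
    using abs_le_lp_norm[OF p x, of a] abs_le_lp_norm[OF p x, of b] by linarith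
  then show ?thesis
    using lp_norm_nonneg[of p \<Gamma> x] by (subst graph_norm_le_iff[OF p x]) auto
qed

lemma abs_edge_le_graph_norm:
  assumes "1 < p" "x \<in> lp_space p \<Gamma>" "E a b"
  shows "\<bar>x a\<bar> + \<bar>x b\<bar> \<le> graph_norm E p \<Gamma> x"
  using graph_norm_le_iff[where E = E and c = "graph_norm E p \<Gamma> x", OF assms(1,2) graph_norm_nonneg]
    assms(3) by simp

lemma graph_norm_scale_le:
  assumes p: "1 < p" and x: "x \<in> lp_space p \<Gamma>"
  shows "graph_norm E p \<Gamma> (\<lambda>\<gamma>. c * x \<gamma>) \<le> \<bar>c\<bar> * graph_norm E p \<Gamma> x"
proof (subst graph_norm_le_iff[OF p lp_scale(1)[OF p x]], goal_cases)
  case 1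
  show ?case by (simp add: graph_norm_nonneg)
next
  case 2
  have "\<bar>c * x a\<bar> + \<bar>c * x b\<bar> \<le> \<bar>c\<bar> * graph_norm E p \<Gamma> x" if "E a b" for a b
    using mult_left_mono[OF abs_edge_le_graph_norm[where E = E, OF p x that], of "\<bar>c\<bar>"]
    by (simp add: abs_mult distrib_left)
  moreover have "\<bar>c\<bar> * lp_norm p \<Gamma> x \<le> 2 * (\<bar>c\<bar> * graph_norm E p \<Gamma> x)"
    using mult_left_mono[OF lp_norm_le_graph_norm, of "\<bar>c\<bar>" p \<Gamma> x E] by simp
  ultimately show ?case by (simp add: lp_scale(2)[OF p x])
qed

lemma everywhere_even_norm_graph_norm:
  assumes p: "1 < p"
  shows "everywhere_even_norm p \<Gamma> (graph_norm E p \<Gamma>)"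
  unfolding everywhere_even_norm_def is_norm_on_def
proof (intro conjI ballI allI)
  fix x y assume x: "x \<in> lp_space p \<Gamma>"
  let ?N = "graph_norm E p \<Gamma>"
  have zero: "?N x = 0" if "lp_norm p \<Gamma> x = 0"
    using graph_norm_le_lp_norm[OF p x, of E] graph_norm_nonneg[of E p \<Gamma> x] that by simp
  moreover have "lp_norm p \<Gamma> x = 0" if "?N x = 0"
    using lp_norm_le_graph_norm[of p \<Gamma> x E] lp_norm_nonneg[of p \<Gamma> x] that by simp
  moreover have "lp_norm p \<Gamma> x = 0 \<longleftrightarrow> x = (\<lambda>\<gamma>. 0)"
    using is_norm_on_lp_norm[OF p, of \<Gamma>] x by (simp add: is_norm_on_def)
  ultimately show "?N x = 0 \<longleftrightarrow> x = (\<lambda>\<gamma>. 0)" by blast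
  show "?N (\<lambda>\<gamma>. c * x \<gamma>) = \<bar>c\<bar> * ?N x" for c
  proof (cases "c = 0")
    case True
    then show ?thesis
      using graph_norm_scale_le[OF p x, of E c] graph_norm_nonneg[of E p \<Gamma> "\<lambda>\<gamma>. c * x \<gamma>"] by simp
  next
    case False
    have "?N (\<lambda>\<gamma>. 1 / c * (c * x \<gamma>)) \<le> \<bar>1 / c\<bar> * ?N (\<lambda>\<gamma>. c * x \<gamma>)"
      by (rule graph_norm_scale_le[OF p lp_scale(1)[OF p x]])
    then have "\<bar>c\<bar> * ?N x \<le> ?N (\<lambda>\<gamma>. c * x \<gamma>)"
      using False by (simp add: field_simps)
    then show ?thesis using graph_norm_scale_le[OF p x, of E c] by simp
  qed
  assume y: "y \<in> lp_space p \<Gamma>"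
  have "\<bar>x a + y a\<bar> + \<bar>x b + y b\<bar> \<le> ?N x + ?N y" if "E a b" for a b
    using abs_edge_le_graph_norm[where E = E, OF p x that] abs_edge_le_graph_norm[where E = E, OF p y that] by linarith
  moreover have "lp_norm p \<Gamma> (\<lambda>\<gamma>. x \<gamma> + y \<gamma>) \<le> 2 * (?N x + ?N y)"
    using lp_add(2)[OF p x y] lp_norm_le_graph_norm[of p \<Gamma> x E] lp_norm_le_graph_norm[of p \<Gamma> y E] by simp
  ultimately show "?N (\<lambda>\<gamma>. x \<gamma> + y \<gamma>) \<le> ?N x + ?N y"
    using graph_norm_nonneg[of E p \<Gamma>] by (subst graph_norm_le_iff[OF p lp_add(1)[OF p x y]]) auto
next
  show "graph_norm E p \<Gamma> (\<lambda>\<gamma>. - x \<gamma>) = graph_norm E p \<Gamma> x" for x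
    by (simp add: graph_norm_def lp_norm_minus)
qed (rule graph_norm_nonneg)+

text \<open>The points are the unit vectors \<open>u a\<close> with \<open>V a\<close> given by \<open>y a > 1 / 2\<close>. Adjacent indices have
  disjoint \<open>V a\<close>, \<open>V b\<close>, so pairwise meeting sets come from an independent set. If smaller
  neighbourhoods are pairwise disjoint, thinning out the index set makes no \<open>b\<close> belong to the
  finite coordinate set of another \<open>a\<close>; then \<open>u a + u b\<close> agrees with \<open>u a\<close> on the coordinates that
  matter near \<open>u a\<close>, and likewise for \<open>b\<close>, so only adjacency of \<open>a\<close> and \<open>b\<close> can keep it out of the ball.\<close>

lemma graph_ball_not_open_dichotomy:
  assumes p: "1 < p" and G: "G \<subseteq> \<Gamma>"
    and E: "\<And>a b. E a b \<Longrightarrow> a \<noteq> b"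
    and edge: "\<And>A. A \<subseteq> G \<Longrightarrow> uncountable A \<Longrightarrow> \<exists>a\<in>A. \<exists>b\<in>A. E a b"
    and nonedge: "\<And>A. A \<subseteq> G \<Longrightarrow> uncountable A \<Longrightarrow> \<exists>a\<in>A. \<exists>b\<in>A. a \<noteq> b \<and> \<not> E a b \<and> \<not> E b a"
  shows "\<not> open_dichotomy G (weak_ball p \<Gamma> (graph_norm E p \<Gamma>))"
proof
  let ?N = "graph_norm E p \<Gamma>"
  let ?B = "weak_ball p \<Gamma> ?N"
  assume dich: "open_dichotomy G ?B"
  define u where "u a = (\<lambda>\<gamma>. if \<gamma> = a then 1 else 0 :: real)" for a :: 'a
  define V where "V a = {y \<in> lp_space p \<Gamma>. y a \<in> {1/2<..}} \<inter> closed_unit_ball (lp_space p \<Gamma>) ?N" for a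
  have uV: "u a \<in> lp_space p \<Gamma>" and uN: "lp_norm p \<Gamma> (u a) \<le> 1" if "a \<in> \<Gamma>" for a
  proof -
    have fs: "finite {a}" "{a} \<subseteq> \<Gamma>" "\<And>\<gamma>. \<gamma> \<notin> {a} \<Longrightarrow> u a \<gamma> = 0" using that by (auto simp: u_def)
    show "u a \<in> lp_space p \<Gamma>" by (rule lp_finite_support(1)[OF fs])
    show "lp_norm p \<Gamma> (u a) \<le> 1"
      using lp_finite_support(2)[where x = "u a" and p = p, OF fs] by (simp add: lp_norm_le_iff[OF p] u_def)
  qed
  have uB: "?N (u a) \<le> 1" if "a \<in> \<Gamma>" for a
    using uN[OF that] E by (subst graph_norm_le_iff[OF p uV[OF that]]) (auto simp: u_def)
  have uuB: "?N (\<lambda>\<gamma>. u a \<gamma> + u b \<gamma>) \<le> 1" if "a \<in> \<Gamma>" "b \<in> \<Gamma>" "\<not> E a b" "\<not> E b a" "a \<noteq> b" for a b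
    using lp_add(2)[OF p uV[OF that(1)] uV[OF that(2)]] uN[OF that(1)] uN[OF that(2)] that(3,4,5) E
    by (subst graph_norm_le_iff[OF p lp_add(1)[OF p uV[OF that(1)] uV[OF that(2)]]]) (auto simp: u_def)
  have "\<forall>a\<in>G. openin ?B (V a) \<and> u a \<in> V a"
  proof (intro ballI conjI)
    fix a assume "a \<in> G"
    then have a: "a \<in> \<Gamma>" using G by blast
    show "openin ?B (V a)"
      unfolding V_def by (intro openin_subtopology_Int openin_weak_lp_coordinate p open_greaterThan)
    show "u a \<in> V a" using uV[OF a] uB[OF a] by (simp add: V_def closed_unit_ball_def u_def)
  qed
  then obtain A where A: "A \<subseteq> G" "uncountable A" and alt:
    "(\<forall>a\<in>A. \<forall>b\<in>A. a \<noteq> b \<longrightarrow> V a \<inter> V b \<noteq> {}) \<or>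
     (\<exists>U. (\<forall>a\<in>A. openin ?B (U a) \<and> u a \<in> U a) \<and> (\<forall>a\<in>A. \<forall>b\<in>A. a \<noteq> b \<longrightarrow> U a \<inter> U b = {}))"
    by (rule open_dichotomyE[OF dich])
  from alt show False
  proof (elim disjE exE conjE)
    assume meet: "\<forall>a\<in>A. \<forall>b\<in>A. a \<noteq> b \<longrightarrow> V a \<inter> V b \<noteq> {}"
    obtain a b where ab: "a \<in> A" "b \<in> A" "E a b" using edge[OF A] by blast
    then obtain y where "y \<in> V a" "y \<in> V b" using meet E by blast
    then have "y \<in> lp_space p \<Gamma>" "?N y \<le> 1" "1 / 2 < y a" "1 / 2 < y b"
      by (auto simp: V_def closed_unit_ball_def)
    then show False using abs_edge_le_graph_norm[where E = E, OF p _ ab(3), of y \<Gamma>] by force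
  next
    fix U assume U: "\<forall>a\<in>A. openin ?B (U a) \<and> u a \<in> U a"
      and disj: "\<forall>a\<in>A. \<forall>b\<in>A. a \<noteq> b \<longrightarrow> U a \<inter> U b = {}"
    have N2: "lp_norm p \<Gamma> y \<le> 2" if "?N y \<le> 1" for y
      using lp_norm_le_graph_norm[of p \<Gamma> y E] that by simp
    have "\<forall>a\<in>A. \<exists>F d. finite F \<and> F \<subseteq> \<Gamma> \<and> 0 < d \<and>
      (\<forall>y\<in>lp_space p \<Gamma>. ?N y \<le> 1 \<longrightarrow> (\<forall>\<gamma>\<in>F. \<bar>y \<gamma> - u a \<gamma>\<bar> < d) \<longrightarrow> y \<in> U a)"
      using U N2 by (intro ballI weak_ball_nbhd_contains_box[OF p, of 2]) auto
    then obtain F d where F: "\<And>a. a \<in> A \<Longrightarrow> finite (F a)" and d: "\<And>a. a \<in> A \<Longrightarrow> 0 < d a"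
      and box: "\<And>a y. a \<in> A \<Longrightarrow> y \<in> lp_space p \<Gamma> \<Longrightarrow> ?N y \<le> 1
        \<Longrightarrow> (\<And>\<gamma>. \<gamma> \<in> F a \<Longrightarrow> \<bar>y \<gamma> - u a \<gamma>\<bar> < d a) \<Longrightarrow> y \<in> U a"
      by metis
    \<comment> \<open>adding \<open>a\<close> to its own coordinate set lets the Delta-system also separate the indices\<close>
    obtain A' R where A': "A' \<subseteq> A" "uncountable A'"
      and R: "\<And>a. a \<in> A' \<Longrightarrow> R \<subseteq> insert a (F a)"
      and root: "\<And>a b. a \<in> A' \<Longrightarrow> b \<in> A' \<Longrightarrow> a \<noteq> b \<Longrightarrow> insert a (F a) \<inter> insert b (F b) = R"
      using delta_system[OF A(2), of "\<lambda>a. insert a (F a)"] F by blast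
    obtain a0 where "a0 \<in> A'" using A'(2) by (metis countable_empty ex_in_conv)
    then have "finite R" using R[of a0] F[of a0] A'(1) by (meson finite.insertI finite_subset subsetD)
    then have unc: "uncountable (A' - R)"
      using A'(2) by (simp add: countable_finite uncountable_minus_countable)
    have "A' - R \<subseteq> G" using A'(1) A(1) by auto
    from nonedge[OF this unc] obtain a b where
      ab: "a \<in> A' - R" "b \<in> A' - R" "a \<noteq> b" "\<not> E a b" "\<not> E b a"
      by (elim bexE conjE) (rule that)
    have "b \<notin> F a" "a \<notin> F b" using root[of a b] ab by auto
    have abA: "a \<in> A" "b \<in> A" and ab\<Gamma>: "a \<in> \<Gamma>" "b \<in> \<Gamma>" using ab A' A G by auto
    let ?y = "\<lambda>\<gamma>. u a \<gamma> + u b \<gamma>"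
    have y: "?y \<in> lp_space p \<Gamma>" "?N ?y \<le> 1"
      using lp_add(1)[OF p uV[OF ab\<Gamma>(1)] uV[OF ab\<Gamma>(2)]] uuB[OF ab\<Gamma> ab(4,5,3)] by auto
    have "?y \<in> U a"
      using \<open>b \<notin> F a\<close> d[OF abA(1)] by (intro box[OF abA(1) y]) (auto simp: u_def)
    moreover have "?y \<in> U b"
      using \<open>a \<notin> F b\<close> d[OF abA(2)] by (intro box[OF abA(2) y]) (auto simp: u_def)
    ultimately show False using disj abA ab(3) by blast
  qed
qed


section \<open>The two balls are not homeomorphic\<close>

theorem mainTheorem4:
  fixes \<Gamma> :: "'a set" and p :: real
  assumes "uncountable \<Gamma>" and "1 < p"
  shows "\<exists>N\<^sub>1 N\<^sub>2 :: ('a \<Rightarrow> real) \<Rightarrow> real.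
    is_norm_on (lp_space p \<Gamma>) N\<^sub>1 \<and>
    is_norm_on (lp_space p \<Gamma>) N\<^sub>2 \<and>
    equivalent_norms_on (lp_space p \<Gamma>) N\<^sub>1 (lp_norm p \<Gamma>) \<and>
    equivalent_norms_on (lp_space p \<Gamma>) N\<^sub>2 (lp_norm p \<Gamma>) \<and>
    \<not> (subtopology (weak_topology (lp_space p \<Gamma>) (lp_norm p \<Gamma>))
          (closed_unit_ball (lp_space p \<Gamma>) N\<^sub>1)
        homeomorphic_space
       subtopology (weak_topology (lp_space p \<Gamma>) (lp_norm p \<Gamma>))
          (closed_unit_ball (lp_space p \<Gamma>) N\<^sub>2))"
proof (rule sierpinski_graph[OF assms(1)])
  fix G and E :: "'a \<Rightarrow> 'a \<Rightarrow> bool"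
  assume G: "G \<subseteq> \<Gamma>" "uncountable G"
    and E: "\<And>a b. E a b \<Longrightarrow> a \<noteq> b \<and> a \<in> G \<and> b \<in> G \<and> E b a"
    and edge: "\<And>A. A \<subseteq> G \<Longrightarrow> uncountable A \<Longrightarrow> \<exists>a\<in>A. \<exists>b\<in>A. E a b"
    and nonedge: "\<And>A. A \<subseteq> G \<Longrightarrow> uncountable A \<Longrightarrow> \<exists>a\<in>A. \<exists>b\<in>A. a \<noteq> b \<and> \<not> E a b"
  let ?N = "graph_norm E p \<Gamma>"
  have even: "everywhere_even_norm p \<Gamma> ?N" by (rule everywhere_even_norm_graph_norm[OF assms(2)])
  have "\<not> open_dichotomy G (weak_ball p \<Gamma> ?N)"
  proof (rule graph_ball_not_open_dichotomy[where E = E, OF assms(2) G(1) _ edge])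
    show "a \<noteq> b" if "E a b" for a b using E[OF that] by blast
    show "\<exists>a\<in>A. \<exists>b\<in>A. a \<noteq> b \<and> \<not> E a b \<and> \<not> E b a" if "A \<subseteq> G" "uncountable A" for A
      using nonedge[OF that] E by metis
  qed
  moreover have "open_dichotomy G (weak_ball p \<Gamma> (lp_norm p \<Gamma>))"
    by (rule lp_ball_open_dichotomy[OF assms(2) G(2)])
  ultimately have "\<not> weak_ball p \<Gamma> (lp_norm p \<Gamma>) homeomorphic_space weak_ball p \<Gamma> ?N"
    using open_dichotomy_homeomorphic by blast
  moreover have "equivalent_norms_on (lp_space p \<Gamma>) ?N (lp_norm p \<Gamma>)"
    by (rule equivalent_norms_on_lpI[OF assms(2) even everywhere_even_norm_lp_norm[OF assms(2)], of 2])
      (simp_all add: graph_norm_le_lp_norm[OF assms(2)] lp_norm_le_graph_norm)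
  moreover have "equivalent_norms_on (lp_space p \<Gamma>) (lp_norm p \<Gamma>) (lp_norm p \<Gamma>)"
    by (simp add: equivalent_norms_on_def)
  moreover have "is_norm_on (lp_space p \<Gamma>) ?N" using even by (simp add: everywhere_even_norm_def)
  ultimately show ?thesis using is_norm_on_lp_norm[OF assms(2), of \<Gamma>] by blast
qed

end
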